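(* Let $\mathbf{Z},\mathbf{Z}^{(1)},\mathbf{Z}^{(2)},\dots$ be independent and identically distributed random vectors in $\mathbb{R}^d$ ($d\ge 2$) with $\mathbb{E}[\mathbf{Z}]=0$, covariance matrix $\mathbf{\Sigma}=\mathbb{E}[\mathbf{Z}\mathbf{Z}^\top]$ having eigenvalues $\lambda_1>\lambda_2\ge\dots\ge\lambda_d>0$, and $\|\mathbf{Z}\|^2\le B$ (almost surely) for some constant $B$. For each stepsize $\beta>0$ let $(\mathbf{v}^{\beta,(n)})_{n\ge 0}$ be the rescaled Oja iteration with stepsize $\beta$ (defined in the context), a Markov chain on the unit sphere $\mathcal{S}^{d-1}=\{\mathbf{w}\in\mathbb{R}^d:\|\mathbf{w}\|=1\}$. If $\mathbf{v}^{\beta,(0)}$ converges weakly to some constant vector $\mathbf{V}^o\in\mathcal{S}^{d-1}$ as $\beta\to 0^+$, then the process $t\mapsto \mathbf{v}^{\beta,(\lfloor t\beta^{-1}\rfloor)}$, $t\ge 0$, converges weakly as $\beta\to 0^+$ to the (deterministic) solution $\mathbf{V}=\mathbf{V}(t)$ of the ordinary differential equation system $$\frac{d\mathbf{V}}{dt}=\left(\mathbf{\Lambda}-(\mathbf{V}^\top\mathbf{\Lambda}\mathbf{V})\,\mathbf{I}_d\right)\mathbf{V},\qquad \mathbf{V}(0)=\mathbf{V}^o,$$ where $\mathbf{\Lambda}=\operatorname{diag}(\lambda_1,\dots,\lambda_d)$.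
   Context: $\|\cdot\|$ is the Euclidean norm and $\Pi\mathbf{w}=\|\mathbf{w}\|^{-1}\mathbf{w}$ for nonzero $\mathbf{w}\in\mathbb{R}^d$. Oja's iteration with stepsize $\beta>0$ is $\mathbf{w}^{(n)}=\Pi\left[\mathbf{w}^{(n-1)}+\beta\,\mathbf{Z}^{(n)}(\mathbf{Z}^{(n)})^\top\mathbf{w}^{(n-1)}\right]$, $n\ge1$. Fix an eigendecomposition $\mathbf{\Sigma}=\mathbf{U}\mathbf{\Lambda}\mathbf{U}^\top$ with $\mathbf{U}$ orthogonal and $\mathbf{\Lambda}=\operatorname{diag}(\lambda_1,\dots,\lambda_d)$, and set $\mathbf{Y}^{(n)}=\mathbf{U}^\top\mathbf{Z}^{(n)}$ and $\mathbf{v}^{(n)}=\mathbf{U}^\top\mathbf{w}^{(n)}$, so that $\mathbb{E}[\mathbf{Y}^{(n)}]=0$, $\mathbb{E}[\mathbf{Y}^{(n)}(\mathbf{Y}^{(n)})^\top]=\mathbf{\Lambda}$. The rescaled Oja iteration is $$\mathbf{v}^{(n)}=\Pi\left\{\mathbf{v}^{(n-1)}+\beta\,\mathbf{Y}^{(n)}(\mathbf{Y}^{(n)})^\top\mathbf{v}^{(n-1)}\right\},\qquad n\ge 1,$$ with $\mathbf{v}^{(0)}\in\mathcal{S}^{d-1}$ (possibly random) independent of the samples; the superscript $\beta$ in $\mathbf{v}^{\beta,(n)}$ records the dependence on the stepsize (the initial vector $\mathbf{v}^{\beta,(0)}$ may depend on $\beta$). Weak convergence of processes is meant in the usual sense of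 convergence in distribution of right-continuous processes with left limits on $[0,\infty)$ (Skorokhod space $D([0,\infty),\mathbb{R}^d)$). *)

theory Defs
  imports "HOL-Probability.Probability"
begin

subsection \<open>Vectors and matrices\<close>

definition outer :: "real ^ 'n \<Rightarrow> real ^ 'n \<Rightarrow> real ^ 'n ^ 'n" where
  "outer x y = (\<chi> i j. x $ i * y $ j)"

definition diag_mat :: "('n \<Rightarrow> real) \<Rightarrow> real ^ 'n ^ 'n" where
  "diag_mat l = (\<chi> i j. if i = j then l i else 0)"

text \<open>The projection \<open>\<Pi>\<close> onto the unit sphere.\<close>

definition sphere_proj :: "real ^ 'n \<Rightarrow> real ^ 'n" where
  "sphere_proj w = w /\<^sub>R norm w"

subsection \<open>The rescaled Oja iteration and its limiting equation\<close>

text \<open>\<open>y n\<close> is the sample used in step \<open>n \<ge> 1\<close>; the entry \<open>y 0\<close> is never used.\<close>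

primrec oja :: "real \<Rightarrow> (nat \<Rightarrow> real ^ 'n) \<Rightarrow> real ^ 'n \<Rightarrow> nat \<Rightarrow> real ^ 'n" where
  "oja \<beta> y v0 0 = v0"
| "oja \<beta> y v0 (Suc n) =
     sphere_proj (oja \<beta> y v0 n + \<beta> *\<^sub>R (outer (y (Suc n)) (y (Suc n)) *v oja \<beta> y v0 n))"

definition oja_ode_solution :: "('n \<Rightarrow> real) \<Rightarrow> real ^ 'n \<Rightarrow> (real \<Rightarrow> real ^ 'n) \<Rightarrow> bool" where
  "oja_ode_solution l V0 V \<longleftrightarrow>
     V 0 = V0 \<and>
     (\<forall>t\<ge>0. (V has_vector_derivative
        ((diag_mat l - (V t \<bullet> (diag_mat l *v V t)) *\<^sub>R mat 1) *v V t)) (at t within {0..}))"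

subsection \<open>The Skorokhod space of paths on the half-line\<close>

text \<open>Paths are functions on the reals that are \<open>undefined\<close> at negative times, so that
  equality of paths is equality on \<open>[0, \<infinity>)\<close>.\<close>

definition cadlag :: "(real \<Rightarrow> 'a :: metric_space) set" where
  "cadlag = {x \<in> extensional {0..}.
     (\<forall>t\<ge>0. (x \<longlongrightarrow> x t) (at_right t)) \<and>
     (\<forall>t>0. \<exists>l. (x \<longlongrightarrow> l) (at_left t))}"

text \<open>The metric is that of Ethier and Kurtz (Markov Processes, Section 3.5). A time change is
  an increasing bijection of \<open>[0, \<infinity>)\<close> whose log-slopes are bounded; \<open>log_slope\<close> is the
  supremum \<open>\<gamma>\<close> of their absolute values.\<close>

definition log_slopes :: "(real \<Rightarrow> real) \<Rightarrow> real set" where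
  "log_slopes \<tau> = {\<bar>ln ((\<tau> s - \<tau> t) / (s - t))\<bar> | s t. 0 \<le> t \<and> t < s}"

definition log_slope :: "(real \<Rightarrow> real) \<Rightarrow> real" where
  "log_slope \<tau> = Sup (log_slopes \<tau>)"

definition time_changes :: "(real \<Rightarrow> real) set" where
  "time_changes = {\<tau>. strict_mono_on {0..} \<tau> \<and> \<tau> ` {0..} = {0..} \<and> bdd_above (log_slopes \<tau>)}"

definition stopped_dist ::
  "(real \<Rightarrow> 'a :: metric_space) \<Rightarrow> (real \<Rightarrow> 'a) \<Rightarrow> (real \<Rightarrow> real) \<Rightarrow> real \<Rightarrow> real" where
  "stopped_dist x y \<tau> u = (SUP t\<in>{0..}. min (dist (x (min t u)) (y (min (\<tau> t) u))) 1)"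

definition skorokhod_dist ::
  "(real \<Rightarrow> 'a :: metric_space) \<Rightarrow> (real \<Rightarrow> 'a) \<Rightarrow> real" where
  "skorokhod_dist x y =
     (INF \<tau>\<in>time_changes.
        max (log_slope \<tau>) (LINT u:{0..}|lborel. exp (- u) * stopped_dist x y \<tau> u))"

definition skorokhod_topology :: "(real \<Rightarrow> 'a :: metric_space) topology" where
  "skorokhod_topology = topology (\<lambda>U. U \<subseteq> cadlag \<and>
     (\<forall>x\<in>U. \<exists>r>0. \<forall>y\<in>cadlag. skorokhod_dist x y < r \<longrightarrow> y \<in> U))"

lemma openin_skorokhod_topology:
  "openin skorokhod_topology U \<longleftrightarrow> U \<subseteq> cadlag \<and>
     (\<forall>x\<in>U. \<exists>r>0. \<forall>y\<in>cadlag. skorokhod_dist x y < r \<longrightarrow> y \<in> U)"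
proof -
  let ?P = "\<lambda>U :: (real \<Rightarrow> 'a) set. U \<subseteq> cadlag \<and>
     (\<forall>x\<in>U. \<exists>r>0. \<forall>y\<in>cadlag. skorokhod_dist x y < r \<longrightarrow> y \<in> U)"
  have int: "?P (S \<inter> T)" if S: "?P S" and T: "?P T" for S T
  proof (intro conjI ballI)
    show "S \<inter> T \<subseteq> cadlag" using S by blast
    fix x assume "x \<in> S \<inter> T"
    then have "x \<in> S" "x \<in> T" by auto
    obtain r where
      "r > 0" "\<forall>y\<in>cadlag. skorokhod_dist x y < r \<longrightarrow> y \<in> S"
      using S \<open>x \<in> S\<close> by blast
    moreover obtain r' where
      "r' > 0" "\<forall>y\<in>cadlag. skorokhod_dist x y < r' \<longrightarrow> y \<in> T"
      using T \<open>x \<in> T\<close> by blast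
    ultimately show "\<exists>r>0. \<forall>y\<in>cadlag. skorokhod_dist x y < r \<longrightarrow> y \<in> S \<inter> T"
      by (intro exI[of _ "min r r'"]) auto
  qed
  have un: "?P (\<Union>K)" if K: "\<forall>S\<in>K. ?P S" for K
  proof (intro conjI ballI)
    show "\<Union>K \<subseteq> cadlag" using K by blast
    fix x assume "x \<in> \<Union>K"
    then obtain S where S: "S \<in> K" "x \<in> S" by blast
    then obtain r where "r > 0" "\<forall>y\<in>cadlag. skorokhod_dist x y < r \<longrightarrow> y \<in> S"
      using K by blast
    then show "\<exists>r>0. \<forall>y\<in>cadlag. skorokhod_dist x y < r \<longrightarrow> y \<in> \<Union>K"
      using S(1) by blast
  qed
  have "istopology ?P"
    unfolding istopology_def
    by (rule conjI; (rule allI)+; (rule impI)+; (rule int un; assumption))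
  then show ?thesis
    by (simp add: skorokhod_topology_def topology_inverse')
qed

lemma topspace_skorokhod_topology: "topspace skorokhod_topology = cadlag"
proof
  show "topspace skorokhod_topology \<subseteq> cadlag"
    using openin_skorokhod_topology openin_topspace by blast
  have "openin skorokhod_topology cadlag"
    unfolding openin_skorokhod_topology using zero_less_one by blast
  then show "cadlag \<subseteq> topspace skorokhod_topology"
    by (rule openin_subset)
qed

subsection \<open>Weak convergence of random elements of a topological space\<close>

definition borel_of :: "'a topology \<Rightarrow> 'a measure" where
  "borel_of T = sigma (topspace T) {U. openin T U}"

definition converges_weakly ::
  "'w measure \<Rightarrow> 'a topology \<Rightarrow> ('i \<Rightarrow> 'w \<Rightarrow> 'a) \<Rightarrow> ('w \<Rightarrow> 'a) \<Rightarrow> 'i filter \<Rightarrow> bool" where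
  "converges_weakly M T X L F \<longleftrightarrow>
     (\<forall>\<^sub>F i in F. X i \<in> measurable M (borel_of T)) \<and>
     L \<in> measurable M (borel_of T) \<and>
     (\<forall>f. continuous_map T euclideanreal f \<and> bounded (f ` topspace T) \<longrightarrow>
        ((\<lambda>i. LINT \<omega>|M. f (X i \<omega>)) \<longlongrightarrow> (LINT \<omega>|M. f (L \<omega>))) F)"

text \<open>Independence of two random elements whose value types may differ
  (\<open>indep_var\<close> forces equal value types).\<close>

definition (in prob_space) indep_elements ::
  "'b measure \<Rightarrow> ('a \<Rightarrow> 'b) \<Rightarrow> 'c measure \<Rightarrow> ('a \<Rightarrow> 'c) \<Rightarrow> bool" where
  "indep_elements S X T Y \<longleftrightarrow>
     X \<in> measurable M S \<and> Y \<in> measurable M T \<and>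
     indep_set (sets (vimage_algebra (space M) X S)) (sets (vimage_algebra (space M) Y T))"

end

theory Submission
  imports Defs
begin

text \<open>Write \<open>F_A v = A v - (v \<bullet> A v) v\<close>. One step of the iteration is
  \<open>v + \<beta> F_A v + O(\<beta>\<^sup>2)\<close> with \<open>A = Y Y\<^sup>T\<close>, and the equation is \<open>V' = F_\<Lambda> V\<close>. Since \<open>F\<close> is linear
  in \<open>A\<close> and \<open>Y\<close> is independent of the past, the first-order noise drops out of
  \<open>E\<parallel>v\<^sub>n - V(n \<beta>)\<parallel>\<^sup>2\<close>, and a discrete Gronwall argument makes this quantity tend to \<open>0\<close> for
  bounded \<open>n \<beta>\<close>. No maximal inequality is needed to pass to the supremum over \<open>[0, T]\<close>: the paths
  of the iteration are Lipschitz up to an error of order \<open>\<beta>\<close>, so a finite grid of times suffices.\<close>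

subsection \<open>The mean field and one step of the iteration\<close>

text \<open>The limit is deterministic and continuous in time, so weak convergence reduces to
  convergence in probability, uniformly on each \<open>[0, T]\<close>; the identity time change then
  bounds the Skorokhod distance. The field is cubic in \<open>v\<close>, so no global Lipschitz
  bound exists; the unit sphere, which neither the chain (almost surely) nor any solution leaves,
  supplies a uniform one. The orders balance as follows. A run up to time \<open>t\<close> has about
  \<open>t / \<beta>\<close> steps, so an error of order \<beta>^2 per step in the squared distance
  is harmless, while one of order \<beta> is not. The cross term between the current error and the
  noise is of order \<beta>, and it is this term that independence removes. The initial error also
  has to be small in mean square: on the sphere the squared distance to \<open>V0\<close> is
  bounded, so weak convergence to a constant makes its expectation tend to 0. Existence for the
  equation comes from a formula, the linear flow of \<Lambda> divided by its norm.\<close>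

definition oja_field :: "real ^ 'n ^ 'n \<Rightarrow> real ^ 'n \<Rightarrow> real ^ 'n" where
  "oja_field A v = (A - (v \<bullet> (A *v v)) *\<^sub>R mat 1) *v v"

text \<open>The working form; the definition keeps the shape of the right-hand side in
  \<open>oja_ode_solution\<close>. For a unit vector \<open>v\<close> this is the component of
  \<open>A *v v\<close> orthogonal to \<open>v\<close>, hence tangent to the sphere.\<close>

lemma oja_field_eq:
  fixes A :: "real ^ ('n::finite) ^ 'n"
  shows "oja_field A v = A *v v - (v \<bullet> (A *v v)) *\<^sub>R v"
  by (simp add: oja_field_def matrix_vector_mult_diff_rdistrib flip: scaleR_matrix_vector_assoc)

lemma quadratic_form_diff_le:
  fixes A :: "real ^ ('n::finite) ^ 'n"
  assumes A: "\<And>x. norm (A *v x) \<le> K * norm x" and "norm v = 1" "norm w = 1"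
  shows "\<bar>v \<bullet> (A *v v) - w \<bullet> (A *v w)\<bar> \<le> 2 * K * norm (v - w)"
proof -
  have "v \<bullet> (A *v v) - w \<bullet> (A *v w) = v \<bullet> (A *v (v - w)) + (v - w) \<bullet> (A *v w)"
    by (simp add: matrix_vector_mult_diff_distrib inner_diff_left inner_diff_right)
  moreover have "\<bar>v \<bullet> (A *v (v - w))\<bar> \<le> K * norm (v - w)"
    using Cauchy_Schwarz_ineq2[of v "A *v (v - w)"] A[of "v - w"] assms(2) by simp
  moreover have "\<bar>(v - w) \<bullet> (A *v w)\<bar> \<le> norm (v - w) * K"
    using Cauchy_Schwarz_ineq2[of "v - w" "A *v w"] A[of w] assms(3)
      mult_left_mono[of "norm (A *v w)" K "norm (v - w)"] by simp
  ultimately show ?thesis by (simp add: algebra_simps)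
qed

lemma oja_field_bound:
  fixes A :: "real ^ ('n::finite) ^ 'n"
  assumes A: "\<And>x. norm (A *v x) \<le> K * norm x" and v: "norm v = 1"
  shows "norm (oja_field A v) \<le> 2 * K"
proof -
  have "norm (oja_field A v) \<le> norm (A *v v) + \<bar>v \<bullet> (A *v v)\<bar>"
    using norm_triangle_ineq4[of "A *v v" "(v \<bullet> (A *v v)) *\<^sub>R v"] v by (simp add: oja_field_eq)
  then show ?thesis using Cauchy_Schwarz_ineq2[of v "A *v v"] A[of v] v by simp
qed

text \<open>The constant is \<open>K + K + 2 * K\<close>: the change of \<open>A *v v\<close>, the
  change of the vector factor, and the change of the quadratic form by
  \<open>quadratic_form_diff_le\<close>.\<close>

lemma oja_field_lipschitz:
  fixes A :: "real ^ ('n::finite) ^ 'n"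
  assumes A: "\<And>x. norm (A *v x) \<le> K * norm x" and v: "norm v = 1" and w: "norm w = 1"
  shows "norm (oja_field A v - oja_field A w) \<le> 4 * K * norm (v - w)"
proof -
  define q where "q x = x \<bullet> (A *v x)" for x
  have "oja_field A v - oja_field A w = A *v (v - w) - q v *\<^sub>R (v - w) - (q v - q w) *\<^sub>R w"
    by (simp add: oja_field_eq q_def matrix_vector_mult_diff_distrib algebra_simps)
  then have "norm (oja_field A v - oja_field A w)
      \<le> norm (A *v (v - w)) + \<bar>q v\<bar> * norm (v - w) + \<bar>q v - q w\<bar> * norm w"
    by (metis (no_types, opaque_lifting) add_mono norm_scaleR norm_triangle_ineq4 norm_triangle_le_diff order_refl)
  moreover have "\<bar>q v\<bar> \<le> K"
    using Cauchy_Schwarz_ineq2[of v "A *v v"] A[of v] v by (simp add: q_def)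
  then have "\<bar>q v\<bar> * norm (v - w) \<le> K * norm (v - w)" by (rule mult_right_mono) simp
  moreover have "\<bar>q v - q w\<bar> \<le> 2 * K * norm (v - w)"
    unfolding q_def by (rule quadratic_form_diff_le[OF A v w])
  ultimately show ?thesis using A[of "v - w"] w by simp
qed

lemma outer_mult_vec: "outer x y *v v = (y \<bullet> v) *\<^sub>R (x :: real ^ ('n::finite))"
  by (simp add: vec_eq_iff outer_def matrix_vector_mult_def inner_vec_def sum_distrib_left mult_ac)

lemma norm_outer_mult_vec_le:
  fixes y :: "real ^ ('n::finite)"
  assumes "(norm y)\<^sup>2 \<le> B"
  shows "norm (outer y y *v x) \<le> B * norm x"
proof -
  have "norm (outer y y *v x) \<le> (norm y * norm x) * norm y"
    using Cauchy_Schwarz_ineq2[of y x] by (simp add: outer_mult_vec mult_right_mono)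
  also have "\<dots> = (norm y)\<^sup>2 * norm x" by (simp add: power2_eq_square)
  also have "\<dots> \<le> B * norm x" using assms by (rule mult_right_mono) simp
  finally show ?thesis .
qed

text \<open>\<open>outer y y\<close> is positive semidefinite, so a step cannot shorten the
  component along \<open>v\<close>. This makes the normalisation well defined and lets divisions by
  the norm be estimated by 1.\<close>

lemma norm_oja_step_ge:
  fixes v y :: "real ^ ('n::finite)"
  assumes "norm v = 1" "0 \<le> \<beta>"
  shows "1 \<le> norm (v + \<beta> *\<^sub>R (outer y y *v v))"
proof -
  have "1 \<le> v \<bullet> (v + \<beta> *\<^sub>R (outer y y *v v))"
    using assms mult_nonneg_nonneg[of \<beta> "(y \<bullet> v) * (y \<bullet> v)"]
    by (simp add: outer_mult_vec inner_right_distrib dot_square_norm inner_commute[of v y] mult.assoc)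
  also have "\<dots> \<le> norm (v + \<beta> *\<^sub>R (outer y y *v v))"
    using norm_cauchy_schwarz[of v "v + \<beta> *\<^sub>R (outer y y *v v)"] assms by simp
  finally show ?thesis .
qed

lemma norm_sphere_proj: "w \<noteq> 0 \<Longrightarrow> norm (sphere_proj w) = 1"
  by (simp add: sphere_proj_def)

lemma norm_oja_step:
  fixes v y :: "real ^ ('n::finite)"
  assumes "norm v = 1" "0 \<le> \<beta>"
  shows "norm (sphere_proj (v + \<beta> *\<^sub>R (outer y y *v v))) = 1"
  using norm_oja_step_ge[OF assms, of y] by (intro norm_sphere_proj) auto

text \<open>With \<open>a = y \<bullet> v\<close>, the unnormalised vector has norm
  \<open>1 + \<beta> * a\<^sup>2\<close> up to second order, and dividing by it produces the term
  \<open>- a\<^sup>2 *\<^sub>R v\<close> of the field. Of the constant 3, two units come from the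
  error in the norm and one from the product of the two first-order corrections.\<close>

lemma oja_step_expansion:
  fixes v y :: "real ^ ('n::finite)"
  assumes v: "norm v = 1" and y: "(norm y)\<^sup>2 \<le> B" and b: "0 \<le> \<beta>"
  shows "norm (sphere_proj (v + \<beta> *\<^sub>R (outer y y *v v)) - v - \<beta> *\<^sub>R oja_field (outer y y) v)
    \<le> 3 * B\<^sup>2 * \<beta>\<^sup>2"
proof -
  define a where "a = y \<bullet> v"
  define w where "w = v + \<beta> *\<^sub>R (outer y y *v v)"
  define r where "r = norm w"
  have w: "w = v + (\<beta> * a) *\<^sub>R y" by (simp add: w_def outer_mult_vec a_def)
  have r1: "1 \<le> r" unfolding r_def w_def by (rule norm_oja_step_ge[OF v b])
  have B0: "0 \<le> B" using y zero_le_power2[of "norm y"] by linarith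
  have av: "\<bar>a\<bar> \<le> norm y" using Cauchy_Schwarz_ineq2[of y v] v by (simp add: a_def)
  have ay: "\<bar>a\<bar> * norm y \<le> B"
    using mult_right_mono[OF av, of "norm y"] y by (simp add: power2_eq_square)
  have aB: "a\<^sup>2 \<le> B" using av y power_mono[OF av, of 2] by simp
  have rB: "r \<le> 1 + \<beta> * B"
  proof -
    have "r \<le> 1 + \<beta> * (\<bar>a\<bar> * norm y)"
      unfolding r_def w using norm_triangle_ineq[of v "(\<beta> * a) *\<^sub>R y"] v b by (simp add: abs_mult mult.assoc)
    then show ?thesis using mult_left_mono[OF ay b] by simp
  qed
  have r2: "r\<^sup>2 = 1 + 2 * \<beta> * a\<^sup>2 + \<beta>\<^sup>2 * a\<^sup>2 * (norm y)\<^sup>2"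
  proof -
    have "r\<^sup>2 = v \<bullet> v + 2 * (\<beta> * a) * (y \<bullet> v) + (\<beta> * a)\<^sup>2 * (y \<bullet> y)"
      unfolding r_def w power2_norm_eq_inner
      by (simp add: inner_simps inner_commute[of v y] power2_eq_square algebra_simps)
    then show ?thesis using v
      by (simp add: dot_square_norm power_mult_distrib) (simp add: power2_eq_square a_def)
  qed
  have aa: "\<beta>\<^sup>2 * (a\<^sup>2 * (norm y)\<^sup>2) \<le> \<beta>\<^sup>2 * (B * B)" "0 \<le> \<beta>\<^sup>2 * (a\<^sup>2 * (norm y)\<^sup>2)"
    using aB y B0 by (auto intro!: mult_left_mono mult_mono)
  have ba: "0 \<le> \<beta> * a\<^sup>2" "\<beta> * a\<^sup>2 \<le> \<beta> * B" using b aB by (auto intro: mult_left_mono)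
  have rr: "0 \<le> (\<beta> * a\<^sup>2) * (r - 1)" "(\<beta> * a\<^sup>2) * (r - 1) \<le> (\<beta> * B) * (\<beta> * B)"
    using ba r1 rB b B0 by (auto intro!: mult_mono)
  \<comment> \<open>The factor \<open>r + 1\<close> turns the square root \<open>r\<close> into a
    polynomial by \<open>r2\<close>, so no Taylor expansion is needed. Both terms on the right lie
    between 0 and \<open>\<beta>\<^sup>2 * B\<^sup>2\<close>, hence so does the absolute value of
    their difference.\<close>
  have "(r + 1) * (r - 1 - \<beta> * a\<^sup>2) = \<beta>\<^sup>2 * (a\<^sup>2 * (norm y)\<^sup>2) - (\<beta> * a\<^sup>2) * (r - 1)"
    using r2 by (simp add: power2_eq_square algebra_simps)
  then have "\<bar>(r + 1) * (r - 1 - \<beta> * a\<^sup>2)\<bar> \<le> \<beta>\<^sup>2 * B\<^sup>2"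
    using aa rr by (simp add: power2_eq_square algebra_simps)
  moreover have "\<bar>r - 1 - \<beta> * a\<^sup>2\<bar> \<le> \<bar>(r + 1) * (r - 1 - \<beta> * a\<^sup>2)\<bar>"
    using r1 mult_right_mono[of 1 "r + 1" "\<bar>r - 1 - \<beta> * a\<^sup>2\<bar>"] by (simp add: abs_mult)
  ultimately have "\<bar>r - 1 - \<beta> * a\<^sup>2\<bar> \<le> \<beta>\<^sup>2 * B\<^sup>2" by linarith
  then have R: "\<bar>1 - r + r * (\<beta> * a\<^sup>2)\<bar> \<le> 2 * (\<beta>\<^sup>2 * B\<^sup>2)"
    using rr by (simp add: power2_eq_square algebra_simps)
  \<comment> \<open>The remainder is regrouped around \<open>w\<close>, whose norm is
    \<open>r\<close>, so that the factor \<open>1 / r\<close> cancels when norms are taken.\<close>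
  have "sphere_proj w - v - \<beta> *\<^sub>R oja_field (outer y y) v
      = ((1 - r + r * (\<beta> * a\<^sup>2)) / r) *\<^sub>R w - (\<beta> * a\<^sup>2) *\<^sub>R ((\<beta> * a) *\<^sub>R y)"
  proof -
    have "oja_field (outer y y) v = a *\<^sub>R y - a\<^sup>2 *\<^sub>R v"
      by (simp add: oja_field_eq outer_mult_vec a_def inner_commute power2_eq_square)
    moreover have "(1 - r + r * (\<beta> * a\<^sup>2)) / r = 1 / r - 1 + \<beta> * a\<^sup>2" using r1 by (simp add: field_simps)
    moreover have "sphere_proj w = (1 / r) *\<^sub>R w" by (simp add: sphere_proj_def r_def inverse_eq_divide)
    moreover have "z *\<^sub>R w - v - \<beta> *\<^sub>R (a *\<^sub>R y - a\<^sup>2 *\<^sub>R v)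
        = (z - 1 + \<beta> * a\<^sup>2) *\<^sub>R w - (\<beta> * a\<^sup>2) *\<^sub>R ((\<beta> * a) *\<^sub>R y)" for z
      by (simp add: w algebra_simps)
    ultimately show ?thesis by metis
  qed
  then have "norm (sphere_proj w - v - \<beta> *\<^sub>R oja_field (outer y y) v)
     \<le> \<bar>(1 - r + r * (\<beta> * a\<^sup>2)) / r\<bar> * r + (\<beta> * a\<^sup>2) * (\<beta> * (\<bar>a\<bar> * norm y))"
    using norm_triangle_ineq4[of "((1 - r + r * (\<beta> * a\<^sup>2)) / r) *\<^sub>R w" "(\<beta> * a\<^sup>2) *\<^sub>R ((\<beta> * a) *\<^sub>R y)"] b
    by (simp add: r_def abs_mult mult.assoc)
  also have "\<bar>(1 - r + r * (\<beta> * a\<^sup>2)) / r\<bar> * r = \<bar>1 - r + r * (\<beta> * a\<^sup>2)\<bar>" using r1 by simp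
  also have "(\<beta> * a\<^sup>2) * (\<beta> * (\<bar>a\<bar> * norm y)) \<le> (\<beta> * B) * (\<beta> * B)"
    using ba ay b B0 aB by (intro mult_mono) auto
  finally show ?thesis using R by (simp add: w_def power2_eq_square algebra_simps)
qed

text \<open>Meant for \<open>F\<close> the sample field at the chain and \<open>G\<close> the mean
  field at the flow. The term \<open>(v - w) \<bullet> (F - G)\<close> is kept exactly, because it
  is small only after averaging; everything else is of order \<beta>^2. The part
  \<open>4 * (c + d)\<close> pairs the remainders with \<open>norm (v - w) \<le> 2\<close>; the
  square bounds the difference of the increments, where \<open>\<beta> \<le> 1\<close> absorbs
  \<beta>^2 into \<beta>.\<close>

lemma norm_step_diff_squared_le:
  fixes v w v' w' F G :: "'a::real_inner"
  assumes "norm v = 1" "norm w = 1" and b: "0 \<le> \<beta>" "\<beta> \<le> 1"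
    and F: "norm F \<le> f" and G: "norm G \<le> g"
    and v': "norm (v' - v - \<beta> *\<^sub>R F) \<le> c * \<beta>\<^sup>2" and w': "norm (w' - w - \<beta> *\<^sub>R G) \<le> d * \<beta>\<^sup>2"
    and cd: "0 \<le> c" "0 \<le> d"
  shows "(norm (v' - w'))\<^sup>2 \<le> (norm (v - w))\<^sup>2 + 2 * \<beta> * ((v - w) \<bullet> (F - G))
     + (4 * (c + d) + (f + g + c + d)\<^sup>2) * \<beta>\<^sup>2"
proof -
  define R where "R = (v' - v - \<beta> *\<^sub>R F) - (w' - w - \<beta> *\<^sub>R G)"
  define E where "E = \<beta> *\<^sub>R (F - G) + R"
  have R: "norm R \<le> (c + d) * \<beta>\<^sup>2"
    unfolding R_def using norm_triangle_ineq4 v' w' by (smt (verit) distrib_right)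
  have D2: "norm (v - w) \<le> 2" using norm_triangle_ineq4[of v w] assms(1,2) by simp
  have b2: "\<beta>\<^sup>2 \<le> \<beta>" using b by (simp add: power2_eq_square mult_left_le)
  have "norm E \<le> \<beta> * (f + g) + (c + d) * \<beta>"
  proof -
    have "norm E \<le> \<beta> * norm (F - G) + norm R"
      unfolding E_def using norm_triangle_ineq[of "\<beta> *\<^sub>R (F - G)" R] b by simp
    moreover have "\<beta> * norm (F - G) \<le> \<beta> * (f + g)"
      using norm_triangle_ineq4[of F G] F G b by (intro mult_left_mono) auto
    moreover have "(c + d) * \<beta>\<^sup>2 \<le> (c + d) * \<beta>" using b2 cd by (intro mult_left_mono) auto
    ultimately show ?thesis using R by linarith
  qed
  then have E: "(norm E)\<^sup>2 \<le> (\<beta> * (f + g + c + d))\<^sup>2"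
    by (intro power_mono) (auto simp: algebra_simps)
  have "(v - w) \<bullet> E = \<beta> * ((v - w) \<bullet> (F - G)) + (v - w) \<bullet> R"
    by (simp add: E_def inner_right_distrib)
  also have "(v - w) \<bullet> R \<le> 2 * ((c + d) * \<beta>\<^sup>2)"
    using norm_cauchy_schwarz[of "v - w" R] mult_mono[OF D2 R] by simp
  finally have DE: "(v - w) \<bullet> E \<le> \<beta> * ((v - w) \<bullet> (F - G)) + 2 * ((c + d) * \<beta>\<^sup>2)" by simp
  have "v' - w' = (v - w) + E"
    by (simp add: E_def R_def algebra_simps)
  then have "(norm (v' - w'))\<^sup>2 = (norm (v - w))\<^sup>2 + 2 * ((v - w) \<bullet> E) + (norm E)\<^sup>2"
    by (simp only: power2_norm_eq_inner) (simp add: inner_simps inner_commute)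
  also have "\<dots> \<le> (norm (v - w))\<^sup>2
      + 2 * (\<beta> * ((v - w) \<bullet> (F - G)) + 2 * ((c + d) * \<beta>\<^sup>2)) + (\<beta> * (f + g + c + d))\<^sup>2"
    by (intro add_mono mult_left_mono DE E) auto
  also have "\<dots> = (norm (v - w))\<^sup>2 + 2 * \<beta> * ((v - w) \<bullet> (F - G))
     + (4 * (c + d) + (f + g + c + d)\<^sup>2) * \<beta>\<^sup>2"
    by (simp only: power_mult_distrib) algebra
  finally show ?thesis .
qed

subsection \<open>The limiting equation\<close>

text \<open>The solution of the linear equation \<open>W' = diag_mat l *v W\<close>,
  \<open>W 0 = V0\<close>, projected to the sphere. The projection removes the radial part of the
  velocity, which turns the linear field into \<open>oja_field\<close>.\<close>

definition oja_flow :: "('n \<Rightarrow> real) \<Rightarrow> real ^ 'n \<Rightarrow> real \<Rightarrow> real ^ 'n" where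
  "oja_flow l V0 t = sphere_proj (\<chi> i. exp (l i * t) * V0 $ i)"

lemma diag_mat_mult_vec: "(diag_mat l *v x) $ i = l i * (x :: real ^ ('n::finite)) $ i"
proof -
  have "(\<Sum>j\<in>UNIV. (if i = j then l i else 0) * x $ j) = (\<Sum>j\<in>UNIV. if j = i then l i * x $ i else 0)"
    by (intro sum.cong) auto
  then show ?thesis by (simp add: diag_mat_def matrix_vector_mult_def)
qed

lemma exp_flow_nonzero:
  assumes "(V0 :: real ^ ('n::finite)) \<noteq> 0" shows "(\<chi> i. exp (l i * t) * V0 $ i) \<noteq> 0"
  using assms by (auto simp: vec_eq_iff)

lemma norm_oja_flow: "(V0 :: real ^ ('n::finite)) \<noteq> 0 \<Longrightarrow> norm (oja_flow l V0 t) = 1"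
  unfolding oja_flow_def by (intro norm_sphere_proj exp_flow_nonzero)

lemma oja_flow_0: "norm (V0 :: real ^ ('n::finite)) = 1 \<Longrightarrow> oja_flow l V0 0 = V0"
  by (simp add: oja_flow_def sphere_proj_def)

text \<open>Quotient rule for \<open>W t\<close> divided by its norm \<open>n t\<close>. The formula
  makes sense for negative times too, so the derivative is two-sided and the later Lipschitz and
  continuity arguments have no boundary case at 0.\<close>

lemma has_vector_derivative_oja_flow:
  fixes V0 :: "real ^ ('n::finite)"
  assumes "V0 \<noteq> 0"
  shows "(oja_flow l V0 has_vector_derivative oja_field (diag_mat l) (oja_flow l V0 t)) (at t)"
proof -
  define W where "W t = (\<chi> i. exp (l i * t) * V0 $ i)" for t
  define n where "n t = norm (W t)" for t
  have n0: "n t \<noteq> 0" for t using exp_flow_nonzero[OF assms] by (simp add: n_def W_def)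
  have W': "(W has_vector_derivative diag_mat l *v W t) (at t)"
    unfolding has_vector_derivative_def
  proof (subst has_derivative_componentwise_within, rule ballI)
    fix b :: "real ^ 'n" assume "b \<in> Basis"
    then obtain i where b: "b = axis i 1" by (auto simp: Basis_vec_def)
    have "((\<lambda>t. exp (l i * t) * V0 $ i) has_field_derivative (l i * (exp (l i * t) * V0 $ i))) (at t)"
      by (auto intro!: derivative_eq_intros)
    then show "((\<lambda>x. W x \<bullet> b) has_derivative (\<lambda>x. (x *\<^sub>R (diag_mat l *v W t)) \<bullet> b)) (at t)"
      by (simp add: b inner_axis diag_mat_mult_vec W_def has_field_derivative_def mult_commute_abs)
  qed
  have n': "(n has_vector_derivative (W t \<bullet> (diag_mat l *v W t)) / n t) (at t)"
  proof -
    have "((\<lambda>t. norm (W t)) has_derivative (\<lambda>x. (x *\<^sub>R (diag_mat l *v W t)) \<bullet> sgn (W t))) (at t)"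
      using has_derivative_compose[OF W'[unfolded has_vector_derivative_def] has_derivative_norm] n0[of t]
      by (simp add: n_def)
    then show ?thesis
      by (simp add: has_vector_derivative_def n_def[abs_def] sgn_div_norm inner_commute divide_inverse mult_ac)
  qed
  have "((\<lambda>t. inverse (n t) *\<^sub>R W t) has_vector_derivative
     (inverse (n t) *\<^sub>R (diag_mat l *v W t) + (- ((W t \<bullet> (diag_mat l *v W t)) / n t) / (n t)\<^sup>2) *\<^sub>R W t)) (at t)"
  proof (rule has_vector_derivative_scaleR[OF _ W'])
    show "((\<lambda>t. inverse (n t)) has_field_derivative (- ((W t \<bullet> (diag_mat l *v W t)) / n t) / (n t)\<^sup>2)) (at t)"
      using n' n0[of t] unfolding has_real_derivative_iff_has_vector_derivative[symmetric]
      by (auto intro!: derivative_eq_intros simp: power2_eq_square divide_inverse)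
  qed
  moreover have "oja_flow l V0 = (\<lambda>t. inverse (n t) *\<^sub>R W t)"
    by (simp add: fun_eq_iff oja_flow_def sphere_proj_def W_def n_def)
  moreover have "oja_field (diag_mat l) (inverse (n t) *\<^sub>R W t) =
     inverse (n t) *\<^sub>R (diag_mat l *v W t) + (- ((W t \<bullet> (diag_mat l *v W t)) / n t) / (n t)\<^sup>2) *\<^sub>R W t"
    by (simp add: oja_field_eq matrix_vector_mult_scaleR divide_inverse power2_eq_square mult_ac)
  ultimately show ?thesis by (simp only:)
qed

section \<open>Uniqueness for the limiting equation\<close>

lemma gronwall_zero:
  fixes g g' :: "real \<Rightarrow> real"
  assumes T: "0 \<le> T" and g: "\<And>t. t \<in> {0..T} \<Longrightarrow> (g has_real_derivative g' t) (at t within {0..})"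
    and g': "\<And>t. t \<in> {0..T} \<Longrightarrow> g' t \<le> K * g t" and "g 0 = 0" and "0 \<le> g T"
  shows "g T = 0"
proof -
  \<comment> \<open>With this integrating factor \<open>h\<close> is nonincreasing, so
    \<open>g T \<le> 0\<close>. At 0 there is only a derivative within \<open>{0..}\<close>; it
    enters through continuity.\<close>
  define h where "h t = exp (- K * t) * g t" for t
  have h': "(h has_real_derivative exp (- K * t) * (g' t - K * g t)) (at t within {0..})"
    if "t \<in> {0..T}" for t
    unfolding h_def by (auto intro!: derivative_eq_intros g that simp: algebra_simps)
  have "h T \<le> h 0"
  proof (rule DERIV_nonpos_imp_decreasing_open[OF T])
    fix x assume x: "0 < x" "x < T"
    then have "at x within {0..} = at x" by (intro at_within_interior) (auto simp: interior_real_atLeast)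
    then show "\<exists>y. (h has_real_derivative y) (at x) \<and> y \<le> 0"
      using h'[of x] g'[of x] x by (intro exI[of _ "exp (- K * x) * (g' x - K * g x)"]) (auto intro: mult_nonneg_nonpos)
  next
    show "continuous_on {0..T} h"
      by (rule DERIV_continuous_on, rule DERIV_subset[OF h']) auto
  qed
  then show ?thesis using assms by (simp add: h_def mult_le_0_iff)
qed

lemma has_real_derivative_inner_self:
  assumes "(D has_vector_derivative D') (at t within S)"
  shows "((\<lambda>t. D t \<bullet> D t) has_real_derivative 2 * (D t \<bullet> D')) (at t within S)"
  using assms unfolding has_vector_derivative_def has_field_derivative_def
  by (auto intro!: derivative_eq_intros simp: fun_eq_iff inner_commute[of D'])

text \<open>Uniqueness relies on a Lipschitz bound that holds on the sphere, so an arbitrary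
  solution must first be shown to stay there. The defect \<open>u = 1 - W \<bullet> W\<close>
  satisfies the linear equation \<open>u' = - 2 * q * u\<close> and starts at 0. Its sign is
  unknown, hence Gronwall for its square; there is no a priori bound on \<open>W\<close>, hence the
  bound on \<open>q\<close> by compactness of \<open>[0, t]\<close>.\<close>

lemma norm_oja_ode_solution:
  fixes V0 :: "real ^ ('n::finite)"
  assumes W: "oja_ode_solution l V0 W" and V0: "norm V0 = 1" and t: "0 \<le> t"
  shows "norm (W t) = 1"
proof -
  define q where "q s = W s \<bullet> (diag_mat l *v W s)" for s
  define u where "u s = 1 - W s \<bullet> W s" for s
  have W': "(W has_vector_derivative oja_field (diag_mat l) (W s)) (at s within {0..})" if "0 \<le> s" for s
    using W that by (simp add: oja_ode_solution_def oja_field_def)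
  have "continuous_on {0..t} W"
    by (rule continuous_on_vector_derivative, rule has_vector_derivative_within_subset[OF W']) auto
  then have "compact (q ` {0..t})"
    unfolding q_def
    by (intro compact_continuous_image continuous_intros
        bounded_linear.continuous_on[OF matrix_vector_mul_bounded_linear]) auto
  then obtain K where "\<forall>x\<in>q ` {0..t}. norm x \<le> K"
    using compact_imp_bounded bounded_iff by blast
  then have K: "- q s \<le> K" if "s \<in> {0..t}" for s using that by (auto simp: abs_le_iff)
  have u': "(u has_real_derivative - 2 * q s * u s) (at s within {0..})" if "0 \<le> s" for s
    using DERIV_diff[OF DERIV_const has_real_derivative_inner_self[OF W'[OF that]], of 1]
    by (simp add: u_def[abs_def] oja_field_eq q_def algebra_simps)
  have "(u t)\<^sup>2 = 0"
  proof (rule gronwall_zero[OF t])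
    show "((\<lambda>s. (u s)\<^sup>2) has_real_derivative - 4 * q s * (u s)\<^sup>2) (at s within {0..})" if "s \<in> {0..t}" for s
      using that by (auto intro!: derivative_eq_intros u' simp: power2_eq_square)
    show "- 4 * q s * (u s)\<^sup>2 \<le> (4 * K) * (u s)\<^sup>2" if "s \<in> {0..t}" for s
      using K[OF that] by (intro mult_right_mono) auto
    show "(u 0)\<^sup>2 = 0" using W V0 by (simp add: oja_ode_solution_def u_def dot_square_norm)
  qed auto
  then show ?thesis by (simp add: u_def dot_square_norm power2_eq_1_iff) (smt (verit) norm_ge_zero)
qed

lemma norm_matrix_vector_mult_le: "norm (A *v x) \<le> onorm ((*v) A) * norm (x :: real ^ ('n::finite))"
  by (rule onorm) (simp add: matrix_vector_mul_bounded_linear)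

lemma oja_ode_solution_unique:
  fixes V0 :: "real ^ ('n::finite)"
  assumes V: "oja_ode_solution l V0 V" and W: "oja_ode_solution l V0 W" and V0: "norm V0 = 1" and t: "0 \<le> t"
  shows "W t = V t"
proof -
  define K where "K = onorm ((*v) (diag_mat l))"
  define D where "D s = W s - V s" for s
  define D' where "D' s = oja_field (diag_mat l) (W s) - oja_field (diag_mat l) (V s)" for s
  have D': "(D has_vector_derivative D' s) (at s within {0..})" if "0 \<le> s" for s
    unfolding D_def D'_def using V W that by (auto intro!: derivative_intros simp: oja_ode_solution_def oja_field_def)
  have DD': "2 * (D s \<bullet> D' s) \<le> (8 * K) * (D s \<bullet> D s)" if "0 \<le> s" for s
  proof -
    have "norm (D' s) \<le> 4 * K * norm (D s)"
      unfolding D'_def D_def K_def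
      by (rule oja_field_lipschitz norm_matrix_vector_mult_le norm_oja_ode_solution V W V0 that)+
    then have "D s \<bullet> D' s \<le> norm (D s) * (4 * K * norm (D s))"
      by (intro order_trans[OF norm_cauchy_schwarz] mult_left_mono) auto
    then show ?thesis by (simp add: dot_square_norm power2_eq_square mult_ac)
  qed
  have "D t \<bullet> D t = 0"
  proof (rule gronwall_zero[OF t])
    show "((\<lambda>s. D s \<bullet> D s) has_real_derivative 2 * (D s \<bullet> D' s)) (at s within {0..})" if "s \<in> {0..t}" for s
      using that by (intro has_real_derivative_inner_self D') auto
    show "2 * (D s \<bullet> D' s) \<le> (8 * K) * (D s \<bullet> D s)" if "s \<in> {0..t}" for s
      using that by (intro DD') auto
    show "D 0 \<bullet> D 0 = 0" using V W by (simp add: D_def oja_ode_solution_def)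
  qed simp
  then show ?thesis by (simp add: D_def)
qed

lemma oja_ode_solution_oja_flow:
  fixes V0 :: "real ^ ('n::finite)"
  assumes "norm V0 = 1"
  shows "oja_ode_solution l V0 (oja_flow l V0)"
proof -
  have "V0 \<noteq> 0" using assms by auto
  from has_vector_derivative_oja_flow[OF this] show ?thesis
    using oja_flow_0[OF assms] unfolding oja_ode_solution_def oja_field_def
    by (blast intro: has_vector_derivative_at_within)
qed

lemma oja_flow_lipschitz:
  fixes V0 :: "real ^ ('n::finite)"
  assumes A: "\<And>x. norm (diag_mat l *v x) \<le> K * norm x" and V0: "V0 \<noteq> 0"
  shows "norm (oja_flow l V0 t - oja_flow l V0 s) \<le> 2 * K * \<bar>t - s\<bar>"
proof -
  have "norm (oja_flow l V0 t - oja_flow l V0 s) \<le> 2 * K * norm (t - s)"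
  proof (rule differentiable_bound[OF convex_UNIV])
    show "(oja_flow l V0 has_derivative (\<lambda>h. h *\<^sub>R oja_field (diag_mat l) (oja_flow l V0 x))) (at x)" for x
      using has_vector_derivative_oja_flow[OF V0] by (simp add: has_vector_derivative_def)
    show "onorm (\<lambda>h. h *\<^sub>R oja_field (diag_mat l) (oja_flow l V0 x)) \<le> 2 * K" for x
      using oja_field_bound[OF A norm_oja_flow[OF V0]]
      by (intro onorm_le) (simp add: mult.commute mult_left_mono)
  qed auto
  then show ?thesis by simp
qed

text \<open>Consistency error of the Euler step: the mean value inequality for the flow minus its
  tangent line. The field has Lipschitz constant \<open>4 * K\<close> and the flow has speed at most
  \<open>2 * K\<close>, whence the factor 8.\<close>

lemma oja_flow_step:
  fixes V0 :: "real ^ ('n::finite)"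
  assumes A: "\<And>x. norm (diag_mat l *v x) \<le> K * norm x" and V0: "V0 \<noteq> 0" and b: "0 \<le> \<beta>"
  shows "norm (oja_flow l V0 (t + \<beta>) - oja_flow l V0 t - \<beta> *\<^sub>R oja_field (diag_mat l) (oja_flow l V0 t))
    \<le> 8 * K\<^sup>2 * \<beta>\<^sup>2"
proof -
  have K0: "0 \<le> K" using A[of V0] V0 by (smt (verit) mult_neg_pos norm_ge_zero zero_less_norm_iff)
  define G where "G = oja_field (diag_mat l) (oja_flow l V0 t)"
  define h where "h s = oja_flow l V0 s - s *\<^sub>R G" for s
  have "norm (h (t + \<beta>) - h t) \<le> (4 * K * (2 * K * \<beta>)) * norm ((t + \<beta>) - t)"
  proof (rule differentiable_bound)
    show "convex {t..t + \<beta>}" by (rule convex_real_interval)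
  next
    fix x assume x: "x \<in> {t..t + \<beta>}"
    have "(h has_vector_derivative (oja_field (diag_mat l) (oja_flow l V0 x) - 1 *\<^sub>R G)) (at x within {t..t + \<beta>})"
      unfolding h_def[abs_def]
      using has_vector_derivative_diff[OF has_vector_derivative_at_within[OF has_vector_derivative_oja_flow[OF V0]]
          has_vector_derivative_scaleR[OF DERIV_ident has_vector_derivative_const]]
      by simp
    then show "(h has_derivative (\<lambda>u. u *\<^sub>R (oja_field (diag_mat l) (oja_flow l V0 x) - G))) (at x within {t..t + \<beta>})"
      by (simp add: has_vector_derivative_def)
    have "norm (oja_field (diag_mat l) (oja_flow l V0 x) - G) \<le> 4 * K * (2 * K * \<beta>)"
    proof -
      have "norm (oja_flow l V0 x - oja_flow l V0 t) \<le> 2 * K * \<bar>x - t\<bar>" by (rule oja_flow_lipschitz[OF A V0])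
      also have "\<dots> \<le> 2 * K * \<beta>" using x K0 by (intro mult_left_mono) auto
      finally have "4 * K * norm (oja_flow l V0 x - oja_flow l V0 t) \<le> 4 * K * (2 * K * \<beta>)"
        using K0 by (intro mult_left_mono) auto
      then show ?thesis
        unfolding G_def by (rule order_trans[OF oja_field_lipschitz[OF A norm_oja_flow[OF V0] norm_oja_flow[OF V0]]])
    qed
    then show "onorm (\<lambda>u. u *\<^sub>R (oja_field (diag_mat l) (oja_flow l V0 x) - G)) \<le> 4 * K * (2 * K * \<beta>)"
      by (intro onorm_le) (simp add: mult.commute mult_left_mono)
  qed (use b in auto)
  moreover have "h (t + \<beta>) - h t = oja_flow l V0 (t + \<beta>) - oja_flow l V0 t - \<beta> *\<^sub>R G"
    by (simp add: h_def algebra_simps)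
  ultimately show ?thesis using b by (simp add: G_def power2_eq_square mult_ac)
qed

subsection \<open>Paths in the Skorokhod space\<close>

lemma has_bochner_integral_exp_Ici:
  "has_bochner_integral lborel (\<lambda>u. indicator {T..} u * exp (- u :: real)) (exp (- T))"
proof (rule has_bochner_integral_nn_integral)
  have "((\<lambda>x::real. - exp (- x)) \<longlongrightarrow> - 0) at_top"
    by (intro tendsto_minus filterlim_compose[OF exp_at_bot] filterlim_uminus_at_bot_at_top)
  then have "(\<integral>\<^sup>+x. ennreal (exp (- x)) * indicator {T..} x \<partial>lborel) = ennreal (0 - (- exp (- T)))"
    by (intro nn_integral_FTC_atLeast) (auto intro!: derivative_eq_intros)
  then show "(\<integral>\<^sup>+x. ennreal (indicator {T..} x * exp (- x)) \<partial>lborel) = ennreal (exp (- T))"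
    by (simp add: ennreal_mult ennreal_indicator mult.commute)
qed auto

lemma id_time_change: "id \<in> time_changes" and log_slope_id: "log_slope id = 0"
proof -
  have "log_slopes id \<subseteq> {0}" by (auto simp: log_slopes_def)
  moreover have "0 \<in> log_slopes id" unfolding log_slopes_def by (rule CollectI, rule exI[of _ 1], rule exI[of _ 0]) auto
  ultimately have "log_slopes id = {0}" by blast
  then show "id \<in> time_changes" "log_slope id = 0"
    by (auto simp: time_changes_def log_slope_def strict_mono_on_def)
qed

text \<open>Supplies the lower bound that lets a single time change bound the real infimum in
  \<open>skorokhod_dist\<close>.\<close>

lemma log_slope_nonneg:
  assumes "\<tau> \<in> time_changes" shows "0 \<le> log_slope \<tau>"
proof -
  have "\<bar>ln ((\<tau> 1 - \<tau> 0) / (1 - 0))\<bar> \<in> log_slopes \<tau>" unfolding log_slopes_def by fastforce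
  then have "\<bar>ln ((\<tau> 1 - \<tau> 0) / (1 - 0))\<bar> \<le> log_slope \<tau>"
    unfolding log_slope_def using assms by (intro cSup_upper) (auto simp: time_changes_def)
  then show ?thesis by linarith
qed

text \<open>The identity time change has log-slope 0. Stopping levels below \<open>T\<close> see at
  most \<delta>; above \<open>T\<close> the truncation of the distance at 1 leaves the tail mass
  \<open>exp (- T)\<close> of the weight.\<close>

lemma skorokhod_dist_le:
  fixes x y :: "real \<Rightarrow> 'a::metric_space"
  assumes T: "0 \<le> T" and d: "\<And>t. 0 \<le> t \<Longrightarrow> t \<le> T \<Longrightarrow> dist (x t) (y t) \<le> \<delta>"
  shows "skorokhod_dist x y \<le> \<delta> + exp (- T)"
proof -
  have d0: "0 \<le> \<delta>" using d[of 0] T zero_le_dist[of "x 0" "y 0"] by linarith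
  define g where "g u = \<delta> * (indicator {0..} u * exp (- u)) + indicator {T..} u * exp (- u)" for u :: real
  have g: "has_bochner_integral lborel g (\<delta> * exp (- 0) + exp (- T))"
    unfolding g_def by (intro has_bochner_integral_add has_bochner_integral_mult_right has_bochner_integral_exp_Ici)
  have s: "stopped_dist x y id u \<le> \<delta> + indicator {T..} u" if "0 \<le> u" for u
    unfolding stopped_dist_def
  proof (rule cSUP_least)
    fix t :: real assume "t \<in> {0..}"
    then have "dist (x (min t u)) (y (min (id t) u)) \<le> \<delta>" if "u < T"
      using that \<open>0 \<le> u\<close> d[of "min t u"] by simp
    then show "min (dist (x (min t u)) (y (min (id t) u))) 1 \<le> \<delta> + indicator {T..} u"
      using d0 by (cases "u < T") (simp_all add: min.coboundedI1 min.coboundedI2)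
  qed simp
  have "(LINT u:{0..}|lborel. exp (- u) * stopped_dist x y id u) \<le> (LINT u|lborel. g u)"
    unfolding set_lebesgue_integral_def
  \<comment> \<open>This rule puts the integrability requirement on the majorant \<open>g\<close>,
    since a non-integrable integrand has integral 0. No measurability of \<open>stopped_dist\<close>
    in \<open>u\<close> has to be shown.\<close>
  proof (rule integral_mono')
    show "integrable lborel g" using g by (rule integrable.intros)
    show "0 \<le> g u" for u using d0 by (simp add: g_def)
    show "indicator {0..} u *\<^sub>R (exp (- u) * stopped_dist x y id u) \<le> g u" for u
    proof (cases "0 \<le> u")
      case True
      then have "exp (- u) * stopped_dist x y id u \<le> exp (- u) * (\<delta> + indicator {T..} u)"
        using s by (intro mult_left_mono) auto
      with True show ?thesis by (simp add: g_def algebra_simps)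
    qed (use d0 in \<open>simp add: g_def\<close>)
  qed
  also have "(LINT u|lborel. g u) = \<delta> + exp (- T)" using g by (simp add: has_bochner_integral_integral_eq)
  finally have I: "(LINT u:{0..}|lborel. exp (- u) * stopped_dist x y id u) \<le> \<delta> + exp (- T)" .
  have "skorokhod_dist x y \<le> max (log_slope id) (LINT u:{0..}|lborel. exp (- u) * stopped_dist x y id u)"
    unfolding skorokhod_dist_def
    by (rule cINF_lower[OF _ id_time_change])
      (auto intro!: bdd_belowI2[where m = 0] simp: le_max_iff_disj log_slope_nonneg)
  also have "\<dots> \<le> \<delta> + exp (- T)" using I d0 by (simp add: log_slope_id)
  finally show ?thesis .
qed

definition step_path :: "real \<Rightarrow> (nat \<Rightarrow> 'a) \<Rightarrow> real \<Rightarrow> 'a" where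
  "step_path \<beta> x = (\<lambda>t\<in>{0..}. x (nat \<lfloor>t / \<beta>\<rfloor>))"

lemma step_path_cadlag:
  assumes b: "0 < \<beta>" shows "step_path \<beta> x \<in> (cadlag :: (real \<Rightarrow> 'a::metric_space) set)"
  unfolding cadlag_def
proof (intro CollectI conjI allI impI)
  show "step_path \<beta> x \<in> extensional {0..}" by (simp add: step_path_def)
next
  fix t :: real assume t: "0 \<le> t"
  define k where "k = \<lfloor>t / \<beta>\<rfloor>"
  have k: "of_int k * \<beta> \<le> t" "t < (of_int k + 1) * \<beta>"
    using b by (simp_all add: k_def flip: pos_le_divide_eq pos_divide_less_eq)
  have "step_path \<beta> x s = step_path \<beta> x t" if "t < s" "s < (of_int k + 1) * \<beta>" for s
  proof -
    have "\<lfloor>s / \<beta>\<rfloor> = k"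
      using that k b by (intro floor_unique) (simp_all add: pos_le_divide_eq pos_divide_less_eq)
    then show ?thesis using that t by (simp add: step_path_def k_def)
  qed
  then have "\<forall>\<^sub>F s in at_right t. step_path \<beta> x s = step_path \<beta> x t"
    using k(2) by (auto simp: eventually_at_right_field)
  then show "(step_path \<beta> x \<longlongrightarrow> step_path \<beta> x t) (at_right t)" by (rule tendsto_eventually)
next
  fix t :: real assume t: "0 < t"
  \<comment> \<open>The ceiling minus 1, not the floor: at a jump time \<open>t\<close> the left
    limit is the value on the preceding step.\<close>
  define k where "k = \<lceil>t / \<beta>\<rceil> - 1"
  have k: "of_int k * \<beta> < t" "t \<le> (of_int k + 1) * \<beta>"
    using b by (simp_all add: k_def pos_divide_le_eq[symmetric] pos_less_divide_eq[symmetric]) linarith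
  have k0: "0 \<le> k" using t b by (simp add: k_def)
  then have k0b: "0 \<le> of_int k * \<beta>" using b by simp
  have "step_path \<beta> x s = x (nat k)" if "of_int k * \<beta> < s" "s < t" for s
  proof -
    have "\<lfloor>s / \<beta>\<rfloor> = k"
      using that k b by (intro floor_unique) (simp_all add: pos_le_divide_eq pos_divide_less_eq)
    then show ?thesis using that k0b by (simp add: step_path_def)
  qed
  then have "\<forall>\<^sub>F s in at_left t. step_path \<beta> x s = x (nat k)"
    using k(1) by (auto simp: eventually_at_left_field)
  then show "\<exists>l. (step_path \<beta> x \<longlongrightarrow> l) (at_left t)" using tendsto_eventually by blast
qed

lemma continuous_path_cadlag:
  fixes V :: "real \<Rightarrow> 'a::metric_space"
  assumes V: "\<And>t. isCont V t"
  shows "(\<lambda>t\<in>{0..}. V t) \<in> cadlag"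
  unfolding cadlag_def
proof (intro CollectI conjI allI impI)
  fix t :: real assume t: "0 \<le> t"
  have "\<forall>\<^sub>F s in at_right t. V s = (\<lambda>t\<in>{0..}. V t) s"
    using t by (auto simp: eventually_at_right_field intro!: exI[of _ "t + 1"])
  moreover have "(V \<longlongrightarrow> V t) (at_right t)"
    using V[of t] by (auto simp: isCont_def intro: tendsto_mono[OF at_le])
  ultimately have "((\<lambda>t\<in>{0..}. V t) \<longlongrightarrow> V t) (at_right t)"
    by (rule tendsto_cong[THEN iffD1])
  then show "((\<lambda>t\<in>{0..}. V t) \<longlongrightarrow> (\<lambda>t\<in>{0..}. V t) t) (at_right t)"
    using t by simp
next
  fix t :: real assume t: "0 < t"
  have "\<forall>\<^sub>F s in at_left t. V s = (\<lambda>t\<in>{0..}. V t) s"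
    using t by (auto simp: eventually_at_left_field intro!: exI[of _ 0])
  moreover have "(V \<longlongrightarrow> V t) (at_left t)"
    using V[of t] by (auto simp: isCont_def intro: tendsto_mono[OF at_le])
  ultimately show "\<exists>l. ((\<lambda>t\<in>{0..}. V t) \<longlongrightarrow> l) (at_left t)"
    using tendsto_cong by blast
qed simp

section \<open>Borel measurability of step paths\<close>

lemma measurable_borel_ofI:
  assumes "f \<in> space M \<rightarrow> topspace T" and "\<And>U. openin T U \<Longrightarrow> f -` U \<inter> space M \<in> sets M"
  shows "f \<in> measurable M (borel_of T)"
  unfolding borel_of_def using assms
  by (intro measurable_measure_of) (auto dest: openin_subset)

lemma space_borel_of: "space (borel_of T) = topspace T"
  by (simp add: borel_of_def space_measure_of_conv)

lemma borel_measurable_continuous_map: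
  assumes f: "continuous_map T euclideanreal f"
  shows "f \<in> borel_measurable (borel_of T)"
proof (rule borel_measurableI)
  fix S :: "real set" assume "open S"
  then have "openin T {x \<in> topspace T. f x \<in> S}"
    using f by (simp add: continuous_map_def)
  then have "{x \<in> topspace T. f x \<in> S} \<in> sets (borel_of T)"
    unfolding borel_of_def using openin_subset
    by (subst sets_measure_of) (auto intro!: sigma_sets.Basic)
  then show "f -` S \<inter> space (borel_of T) \<in> sets (borel_of T)"
    by (simp add: space_borel_of Int_def conj_commute vimage_def)
qed

text \<open>Continuity of \<open>step_path \<beta>\<close> from the product topology on sequences to
  the Skorokhod topology. Times after \<open>T\<close> contribute at most \<open>exp (- T)\<close>
  to the distance, and up to \<open>T\<close> the path reads finitely many terms of the
  sequence.\<close>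

lemma open_vimage_step_path:
  fixes U :: "(real \<Rightarrow> 'a::metric_space) set"
  assumes b: "0 < \<beta>" and U: "openin skorokhod_topology U"
  shows "open (step_path \<beta> -` U)"
proof (subst open_subopen, rule ballI)
  fix x assume "x \<in> step_path \<beta> -` U"
  then obtain r where r: "r > 0" "\<And>y. y \<in> cadlag \<Longrightarrow> skorokhod_dist (step_path \<beta> x) y < r \<Longrightarrow> y \<in> U"
    using U unfolding openin_skorokhod_topology by blast
  have "((\<lambda>T::real. exp (- T)) \<longlongrightarrow> 0) at_top"
    by (intro filterlim_compose[OF exp_at_bot] filterlim_uminus_at_bot_at_top)
  then have "\<forall>\<^sub>F T in at_top. exp (- T) < r / 2 \<and> (0::real) \<le> T"
    using r(1) eventually_ge_at_top[of 0] by (auto intro!: eventually_conj dest: order_tendstoD(2)[where a = "r / 2"])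
  then obtain T :: real where T: "exp (- T) < r / 2" "0 \<le> T" by (auto dest: eventually_happens)
  define N where "N = nat \<lfloor>T / \<beta>\<rfloor>"
  define O' where "O' = (\<Inter>n\<in>{..N}. {y :: nat \<Rightarrow> 'a. dist (x n) (y n) < r / 2})"
  have "open O'" unfolding O'_def
    by (intro open_INT ballI open_Collect_less continuous_intros continuous_on_product_coordinates) auto
  moreover have "x \<in> O'" using r(1) by (simp add: O'_def)
  moreover have "step_path \<beta> y \<in> U" if y: "y \<in> O'" for y
  proof (rule r(2)[OF step_path_cadlag[OF b]])
    have "dist (step_path \<beta> x t) (step_path \<beta> y t) \<le> r / 2" if "0 \<le> t" "t \<le> T" for t
    proof -
      have "nat \<lfloor>t / \<beta>\<rfloor> \<le> N"
        unfolding N_def using that b by (intro nat_mono floor_mono divide_right_mono) auto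
      then show ?thesis using y that by (auto simp: O'_def step_path_def intro: less_imp_le)
    qed
    then have "skorokhod_dist (step_path \<beta> x) (step_path \<beta> y) \<le> r / 2 + exp (- T)"
      by (rule skorokhod_dist_le[OF T(2)])
    then show "skorokhod_dist (step_path \<beta> x) (step_path \<beta> y) < r" using T(1) by simp
  qed
  ultimately show "\<exists>T. open T \<and> x \<in> T \<and> T \<subseteq> step_path \<beta> -` U" by (intro exI[of _ O']) auto
qed

lemma measurable_step_path:
  fixes v :: "nat \<Rightarrow> 'w \<Rightarrow> 'a::{metric_space, second_countable_topology}"
  assumes b: "0 < \<beta>" and v: "\<And>n. v n \<in> borel_measurable M"
  shows "(\<lambda>\<omega>. step_path \<beta> (\<lambda>n. v n \<omega>)) \<in> measurable M (borel_of skorokhod_topology)"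
proof (rule measurable_borel_ofI)
  show "(\<lambda>\<omega>. step_path \<beta> (\<lambda>n. v n \<omega>)) \<in> space M \<rightarrow> topspace skorokhod_topology"
    using b by (simp add: topspace_skorokhod_topology step_path_cadlag)
  fix U :: "(real \<Rightarrow> 'a) set" assume "openin skorokhod_topology U"
  then have "open (step_path \<beta> -` U)" by (rule open_vimage_step_path[OF b])
  moreover have "(\<lambda>\<omega> n. v n \<omega>) \<in> measurable M (PiM UNIV (\<lambda>_. borel))"
    by (rule measurable_PiM_single') (auto simp: v)
  \<comment> \<open>Second countability makes the product sigma-algebra the Borel sigma-algebra of
    the product topology.\<close>
  then have "(\<lambda>\<omega> n. v n \<omega>) \<in> borel_measurable M"
    by (simp cong: measurable_cong_sets add: sets_PiM_equal_borel)
  ultimately have "(\<lambda>\<omega> n. v n \<omega>) -` (step_path \<beta> -` U) \<inter> space M \<in> sets M"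
    by (intro measurable_sets[of _ _ borel]) auto
  then show "(\<lambda>\<omega>. step_path \<beta> (\<lambda>n. v n \<omega>)) -` U \<inter> space M \<in> sets M"
    by (simp add: vimage_def)
qed

subsection \<open>Mean square error of the iteration\<close>

text \<open>\<open>N\<close> is arbitrary because the lemma serves twice: on the probability space,
  and on \<open>PiM {..n}\<close>, where it presents the chain as a measurable function of the first
  coordinates.\<close>

lemma measurable_oja:
  fixes x :: "'a \<Rightarrow> nat \<Rightarrow> real ^ ('n::finite)"
  assumes "\<And>k. k \<le> n \<Longrightarrow> (\<lambda>\<omega>. x \<omega> k) \<in> borel_measurable N"
  shows "(\<lambda>\<omega>. oja \<beta> (x \<omega>) (x \<omega> 0) n) \<in> borel_measurable N"
  using assms
proof (induction n)
  case (Suc n)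
  note [measurable] = Suc.IH[OF Suc.prems] Suc.prems[OF order_refl]
  show ?case by (simp add: sphere_proj_def outer_mult_vec)
qed simp

lemma oja_cong:
  "(\<And>k. k < n \<Longrightarrow> y (Suc k) = y' (Suc k)) \<Longrightarrow> oja \<beta> y v n = oja \<beta> y' v n"
  by (induction n) simp_all

text \<open>Linearity in \<open>A\<close>, written entrywise: each summand is a function of the
  vectors times an entry of \<open>A\<close>. When \<open>A\<close> is random and independent of
  \<open>v\<close>, expectations factorise term by term, without conditional expectations.\<close>

lemma inner_oja_field:
  fixes v w :: "real ^ ('n::finite)"
  shows "w \<bullet> oja_field A v = (\<Sum>i\<in>UNIV. \<Sum>j\<in>UNIV. (w $ i * v $ j - (w \<bullet> v) * (v $ i * v $ j)) * A $ i $ j)"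
proof -
  have q: "x \<bullet> (A *v v) = (\<Sum>i\<in>UNIV. \<Sum>j\<in>UNIV. x $ i * v $ j * A $ i $ j)" for x
    by (simp add: inner_vec_def matrix_vector_mult_def sum_distrib_left mult_ac)
  have "w \<bullet> oja_field A v = w \<bullet> (A *v v) - (w \<bullet> v) * (v \<bullet> (A *v v))"
    by (simp add: oja_field_eq inner_diff_right)
  then show ?thesis
    by (simp add: q sum_subtractf[symmetric] sum_distrib_left left_diff_distrib mult.assoc)
qed

text \<open>From \<open>1 + x \<le> exp x\<close>. The crude \<open>c * n\<close> suffices: in use
  \<open>c\<close> is of order \<beta>^2 and \<open>n\<close> of order
  \<open>1 / \<beta>\<close>.\<close>

lemma discrete_gronwall:
  fixes a :: "nat \<Rightarrow> real"
  assumes a: "\<And>n. a (Suc n) \<le> (1 + x) * a n + c" and x: "0 \<le> x" and c: "0 \<le> c" and a0: "0 \<le> a 0"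
  shows "a n \<le> exp (x * n) * (a 0 + c * n)"
proof (induction n)
  case (Suc n)
  have "(1 + x) * a n \<le> (1 + x) * (exp (x * n) * (a 0 + c * n))"
    using Suc x by (intro mult_left_mono) auto
  also have "\<dots> \<le> exp x * (exp (x * n) * (a 0 + c * n))"
    using a0 c by (intro mult_right_mono) auto
  also have "\<dots> = exp (x * Suc n) * (a 0 + c * n)" by (simp add: exp_add algebra_simps)
  finally have "a (Suc n) \<le> exp (x * Suc n) * (a 0 + c * n) + c" using a[of n] by simp
  moreover have "1 * c \<le> exp (x * Suc n) * c"
    using c x by (intro mult_right_mono) auto
  moreover have "exp (x * Suc n) * (a 0 + c * Suc n) = exp (x * Suc n) * (a 0 + c * n) + exp (x * Suc n) * c"
    by (simp only: of_nat_Suc) algebra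
  ultimately show ?case by linarith
qed simp

text \<open>Between \<open>s\<close> and \<open>t\<close> there are at most
  \<open>(t - s) / \<beta> + 1\<close> jumps; the extra jump is the source of the summand
  \<beta>.\<close>

lemma step_path_modulus:
  fixes x :: "nat \<Rightarrow> 'a::metric_space"
  assumes x: "\<And>n. dist (x n) (x (Suc n)) \<le> c * \<beta>" and b: "0 < \<beta>" and c: "0 \<le> c" and s: "0 \<le> s" "s \<le> t"
  shows "dist (step_path \<beta> x s) (step_path \<beta> x t) \<le> c * (t - s + \<beta>)"
proof -
  have d: "dist (x m) (x (m + k)) \<le> k * (c * \<beta>)" for m k
  proof (induction k)
    case (Suc k)
    have "dist (x m) (x (m + Suc k)) \<le> dist (x m) (x (m + k)) + dist (x (m + k)) (x (m + Suc k))"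
      by (rule dist_triangle)
    then show ?case using Suc x[of "m + k"] by (simp add: algebra_simps)
  qed simp
  define m where "m = nat \<lfloor>s / \<beta>\<rfloor>"
  define n where "n = nat \<lfloor>t / \<beta>\<rfloor>"
  have mn: "m \<le> n" unfolding m_def n_def using s b by (intro nat_mono floor_mono divide_right_mono) auto
  have "real n \<le> t / \<beta>" "s / \<beta> < real m + 1" unfolding m_def n_def using s b by (simp_all)
  then have "real (n - m) \<le> (t - s) / \<beta> + 1" using mn by (simp add: of_nat_diff diff_divide_distrib)
  then have "real (n - m) * (c * \<beta>) \<le> ((t - s) / \<beta> + 1) * (c * \<beta>)" using c b by (intro mult_right_mono) auto
  also have "\<dots> = c * (t - s + \<beta>)" using b by (simp add: field_simps)
  finally show ?thesis using d[of m "n - m"] mn s by (simp add: step_path_def m_def n_def)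
qed

text \<open>One sequence carries the initial vector at index 0 and the samples from index 1 on, so
  that all independence is a single \<open>indep_vars\<close> assumption and the past of step
  \<open>Suc n\<close> is \<open>X 0, ..., X n\<close>. There is no clash, because
  \<open>oja\<close> never reads entry 0 of its samples.\<close>

locale oja_chain = prob_space M for M :: "'w measure" +
  fixes X :: "nat \<Rightarrow> 'w \<Rightarrow> real ^ ('n::finite)" and S :: "real ^ 'n ^ 'n" and B \<beta> :: real
  assumes indep: "indep_vars (\<lambda>_. borel) X UNIV"
    and norm_initial: "AE \<omega> in M. norm (X 0 \<omega>) = 1"
    and sample_bound: "\<And>n. AE \<omega> in M. (norm (X (Suc n) \<omega>))\<^sup>2 \<le> B"
    and second_moment: "\<And>n i j. expectation (\<lambda>\<omega>. X (Suc n) \<omega> $ i * X (Suc n) \<omega> $ j) = S $ i $ j"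
    and stepsize: "0 < \<beta>" "\<beta> \<le> 1"
begin

definition chain :: "nat \<Rightarrow> 'w \<Rightarrow> real ^ 'n" where
  "chain n \<omega> = oja \<beta> (\<lambda>k. X k \<omega>) (X 0 \<omega>) n"

lemma measurable_X [measurable]: "X n \<in> borel_measurable M"
  using indep by (simp add: indep_vars_def)

lemma measurable_chain [measurable]: "chain n \<in> borel_measurable M"
  unfolding chain_def[abs_def] by (rule measurable_oja) simp

lemma chain_Suc:
  "chain (Suc n) \<omega> = sphere_proj (chain n \<omega> + \<beta> *\<^sub>R (outer (X (Suc n) \<omega>) (X (Suc n) \<omega>) *v chain n \<omega>))"
  by (simp add: chain_def)

lemma bound_nonneg: "0 \<le> B"
proof -
  obtain \<omega> where "(norm (X (Suc 0) \<omega>))\<^sup>2 \<le> B"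
    using sample_bound[of 0] AE_False eventually_mono by blast
  then show ?thesis using zero_le_power2 order_trans by blast
qed

lemma AE_norm_chain: "AE \<omega> in M. norm (chain n \<omega>) = 1"
proof (induction n)
  case 0 then show ?case using norm_initial by (simp add: chain_def)
next
  case (Suc n) then show ?case by eventually_elim (use stepsize in \<open>simp add: chain_Suc norm_oja_step\<close>)
qed

lemma AE_chain_step: "AE \<omega> in M. norm (chain (Suc n) \<omega> - chain n \<omega>
    - \<beta> *\<^sub>R oja_field (outer (X (Suc n) \<omega>) (X (Suc n) \<omega>)) (chain n \<omega>)) \<le> 3 * B\<^sup>2 * \<beta>\<^sup>2"
  using AE_norm_chain[of n] sample_bound[of n]
  by eventually_elim (use stepsize in \<open>simp add: chain_Suc oja_step_expansion\<close>)

text \<open>The quantifier over \<open>n\<close> stands under \<open>AE\<close>: one null set serves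
  the whole path, as \<open>step_path_modulus\<close> demands.\<close>

lemma AE_chain_increment:
  "AE \<omega> in M. \<forall>n. dist (chain n \<omega>) (chain (Suc n) \<omega>) \<le> (2 * B + 3 * B\<^sup>2) * \<beta>"
  unfolding AE_all_countable
proof
  fix n
  show "AE \<omega> in M. dist (chain n \<omega>) (chain (Suc n) \<omega>) \<le> (2 * B + 3 * B\<^sup>2) * \<beta>"
    using AE_norm_chain[of n] AE_chain_step[of n] sample_bound[of n]
  proof eventually_elim
    case (elim \<omega>)
    let ?F = "oja_field (outer (X (Suc n) \<omega>) (X (Suc n) \<omega>)) (chain n \<omega>)"
    have "norm ?F \<le> 2 * B"
      by (rule oja_field_bound[OF norm_outer_mult_vec_le]) (use elim in auto)
    then have "norm (\<beta> *\<^sub>R ?F) \<le> 2 * B * \<beta>" using stepsize by (simp add: mult.commute)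
    moreover have "3 * B\<^sup>2 * \<beta>\<^sup>2 \<le> 3 * B\<^sup>2 * \<beta>"
      using stepsize by (intro mult_left_mono) (auto simp: power2_eq_square mult_left_le)
    moreover have "norm (chain (Suc n) \<omega> - chain n \<omega>)
        \<le> norm (chain (Suc n) \<omega> - chain n \<omega> - \<beta> *\<^sub>R ?F) + norm (\<beta> *\<^sub>R ?F)"
      by (metis diff_add_cancel norm_triangle_ineq)
    ultimately show ?case using elim(2) by (simp add: dist_norm norm_minus_commute algebra_simps)
  qed
qed

lemma indep_chain_sample: "indep_var borel (chain n) borel (X (Suc n))"
proof -
  define g where "g = (\<lambda>x. oja \<beta> x (x 0) n :: real ^ 'n)"
  have "g \<in> borel_measurable (PiM {..n} (\<lambda>_. borel))"
    unfolding g_def by (rule measurable_oja) (auto intro: measurable_component_singleton)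
  moreover have "(\<lambda>x. x (Suc n)) \<in> borel_measurable (PiM {Suc n} (\<lambda>_. borel))"
    by (rule measurable_component_singleton) simp
  moreover have "indep_var (PiM {..n} (\<lambda>_. borel)) (\<lambda>\<omega>. restrict (\<lambda>i. X i \<omega>) {..n})
      (PiM {Suc n} (\<lambda>_. borel)) (\<lambda>\<omega>. restrict (\<lambda>i. X i \<omega>) {Suc n})"
    by (rule indep_var_restrict[OF indep]) auto
  ultimately have "indep_var borel (g \<circ> (\<lambda>\<omega>. restrict (\<lambda>i. X i \<omega>) {..n}))
      borel ((\<lambda>x. x (Suc n)) \<circ> (\<lambda>\<omega>. restrict (\<lambda>i. X i \<omega>) {Suc n}))"
    by (intro indep_var_compose)
  \<comment> \<open>Restriction makes the coordinates beyond \<open>n\<close>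
    \<open>undefined\<close>; \<open>oja_cong\<close> applies because \<open>n\<close> steps read
    none of them.\<close>
  moreover have "g \<circ> (\<lambda>\<omega>. restrict (\<lambda>i. X i \<omega>) {..n}) = chain n"
    by (auto simp: fun_eq_iff g_def chain_def intro: oja_cong)
  moreover have "(\<lambda>x. x (Suc n)) \<circ> (\<lambda>\<omega>. restrict (\<lambda>i. X i \<omega>) {Suc n}) = X (Suc n)"
    by (simp add: fun_eq_iff)
  ultimately show ?thesis by simp
qed

text \<open>Conditionally on the past, the random field has mean \<open>oja_field S\<close>, since
  \<^term>\<open>oja_field\<close> is linear in the matrix.\<close>

lemma
  assumes w: "norm w = 1"
  shows expectation_inner_field:
    "expectation (\<lambda>\<omega>. (chain n \<omega> - w) \<bullet> oja_field (outer (X (Suc n) \<omega>) (X (Suc n) \<omega>)) (chain n \<omega>))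
     = expectation (\<lambda>\<omega>. (chain n \<omega> - w) \<bullet> oja_field S (chain n \<omega>))"
   and integrable_inner_sample_field:
    "integrable M (\<lambda>\<omega>. (chain n \<omega> - w) \<bullet> oja_field (outer (X (Suc n) \<omega>) (X (Suc n) \<omega>)) (chain n \<omega>))"
   and integrable_inner_mean_field:
    "integrable M (\<lambda>\<omega>. (chain n \<omega> - w) \<bullet> oja_field S (chain n \<omega>))"
proof -
  \<comment> \<open>\<open>H i j\<close> and \<open>Q i j\<close> are the two factors of a summand
    in \<open>inner_oja_field\<close>: one depends on the past, the other on the new sample. On the
    sphere \<open>H i j\<close> is bounded by \<open>2 * 1 + 2 * (1 * 1) = 4\<close>.\<close>
  define H where "H i j v = (v - w) $ i * v $ j - ((v - w) \<bullet> v) * (v $ i * v $ j)" for i j and v :: "real ^ 'n"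
  define Q where "Q i j y = y $ i * y $ j" for i j and y :: "real ^ 'n"
  have H_meas [measurable]: "H i j \<in> borel_measurable borel" for i j
    unfolding H_def by (intro borel_measurable_continuous_onI continuous_intros)
  have Q_meas [measurable]: "Q i j \<in> borel_measurable borel" for i j
    unfolding Q_def by (intro borel_measurable_continuous_onI continuous_intros)
  have H_int: "integrable M (\<lambda>\<omega>. H i j (chain n \<omega>))" for i j
  proof (rule integrable_const_bound[where B = 4])
    show "AE \<omega> in M. norm (H i j (chain n \<omega>)) \<le> 4" using AE_norm_chain[of n]
    proof eventually_elim
      case (elim \<omega>)
      let ?v = "chain n \<omega>"
      have d: "norm (?v - w) \<le> 2" using norm_triangle_ineq4[of ?v w] elim w by simp
      have c: "\<bar>?v $ k\<bar> \<le> 1" for k using component_le_norm_cart[of ?v k] elim by simp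
      have "\<bar>(?v - w) $ i\<bar> \<le> 2" using component_le_norm_cart[of "?v - w" i] d by simp
      then have "\<bar>(?v - w) $ i * ?v $ j\<bar> \<le> 2 * 1"
        unfolding abs_mult using c by (intro mult_mono) auto
      moreover have "\<bar>(?v - w) \<bullet> ?v\<bar> \<le> 2" using Cauchy_Schwarz_ineq2[of "?v - w" ?v] d elim by simp
      then have "\<bar>((?v - w) \<bullet> ?v) * (?v $ i * ?v $ j)\<bar> \<le> 2 * (1 * 1)"
        unfolding abs_mult using c by (intro mult_mono) auto
      ultimately show ?case unfolding H_def real_norm_def by linarith
    qed
  qed simp
  have Q_int: "integrable M (\<lambda>\<omega>. Q i j (X (Suc n) \<omega>))" for i j
  proof (rule integrable_const_bound[where B = B])
    show "AE \<omega> in M. norm (Q i j (X (Suc n) \<omega>)) \<le> B" using sample_bound[of n]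
    proof eventually_elim
      case (elim \<omega>)
      have "\<bar>X (Suc n) \<omega> $ i\<bar> * \<bar>X (Suc n) \<omega> $ j\<bar> \<le> norm (X (Suc n) \<omega>) * norm (X (Suc n) \<omega>)"
        by (intro mult_mono component_le_norm_cart) auto
      then show ?case using elim by (simp add: Q_def abs_mult power2_eq_square)
    qed
  qed simp
  have "indep_var borel (H i j \<circ> chain n) borel (Q i j \<circ> X (Suc n))" for i j
    by (rule indep_var_compose[OF indep_chain_sample]) auto
  then have ind: "indep_var borel (\<lambda>\<omega>. H i j (chain n \<omega>)) borel (\<lambda>\<omega>. Q i j (X (Suc n) \<omega>))" for i j
    by (simp add: comp_def)
  have E: "expectation (\<lambda>\<omega>. H i j (chain n \<omega>) * Q i j (X (Suc n) \<omega>)) = expectation (\<lambda>\<omega>. H i j (chain n \<omega>)) * S $ i $ j" for i j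
    using indep_var_lebesgue_integral[OF ind H_int Q_int] second_moment by (simp add: Q_def)
  have I: "integrable M (\<lambda>\<omega>. H i j (chain n \<omega>) * Q i j (X (Suc n) \<omega>))" for i j
    using indep_var_integrable[OF ind H_int Q_int] .
  have e1: "(\<lambda>\<omega>. (chain n \<omega> - w) \<bullet> oja_field (outer (X (Suc n) \<omega>) (X (Suc n) \<omega>)) (chain n \<omega>))
     = (\<lambda>\<omega>. \<Sum>i\<in>UNIV. \<Sum>j\<in>UNIV. H i j (chain n \<omega>) * Q i j (X (Suc n) \<omega>))"
    by (simp add: inner_oja_field H_def Q_def outer_def fun_eq_iff)
  have e2: "(\<lambda>\<omega>. (chain n \<omega> - w) \<bullet> oja_field S (chain n \<omega>))
     = (\<lambda>\<omega>. \<Sum>i\<in>UNIV. \<Sum>j\<in>UNIV. H i j (chain n \<omega>) * S $ i $ j)"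
    by (simp add: inner_oja_field H_def fun_eq_iff)
  show "expectation (\<lambda>\<omega>. (chain n \<omega> - w) \<bullet> oja_field (outer (X (Suc n) \<omega>) (X (Suc n) \<omega>)) (chain n \<omega>))
     = expectation (\<lambda>\<omega>. (chain n \<omega> - w) \<bullet> oja_field S (chain n \<omega>))"
    unfolding e1 e2 by (simp add: Bochner_Integration.integral_sum I H_int E)
  show "integrable M (\<lambda>\<omega>. (chain n \<omega> - w) \<bullet> oja_field (outer (X (Suc n) \<omega>) (X (Suc n) \<omega>)) (chain n \<omega>))"
    unfolding e1 by (simp add: I)
  show "integrable M (\<lambda>\<omega>. (chain n \<omega> - w) \<bullet> oja_field S (chain n \<omega>))"
    unfolding e2 by (simp add: H_int)
qed

lemma integrable_norm_chain_diff_squared: "integrable M (\<lambda>\<omega>. (norm (chain n \<omega> - w))\<^sup>2)"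
proof (rule integrable_const_bound[where B = "(1 + norm w)\<^sup>2"])
  show "AE \<omega> in M. norm ((norm (chain n \<omega> - w))\<^sup>2) \<le> (1 + norm w)\<^sup>2" using AE_norm_chain[of n]
    by eventually_elim (use norm_triangle_ineq4[of "chain n _" w] in \<open>auto intro!: power_mono\<close>, metis)
qed simp

lemma integrable_inner_chain_diff: "integrable M (\<lambda>\<omega>. (chain n \<omega> - w) \<bullet> G)"
proof (rule integrable_const_bound[where B = "(1 + norm w) * norm G"])
  show "AE \<omega> in M. norm ((chain n \<omega> - w) \<bullet> G) \<le> (1 + norm w) * norm G" using AE_norm_chain[of n]
  proof eventually_elim
    case (elim \<omega>)
    have "norm (chain n \<omega> - w) \<le> 1 + norm w" using norm_triangle_ineq4[of "chain n \<omega>" w] elim by simp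
    then show ?case using Cauchy_Schwarz_ineq2[of "chain n \<omega> - w" G]
      by (smt (verit) mult_right_mono norm_ge_zero real_norm_def)
  qed
qed simp

text \<open>Averaging replaces the sample field by the mean field at the same point, and only then
  does the Lipschitz bound apply: it gives the factor \<open>2 * \<beta> * (4 * K)\<close>. In use
  \<open>w\<close> and \<open>w'\<close> are consecutive points of the flow and \<open>d\<close>
  comes from \<open>oja_flow_step\<close>.\<close>

lemma expectation_step:
  assumes A: "\<And>x. norm (S *v x) \<le> K * norm x" and w: "norm w = 1" "norm w' = 1"
    and ww': "norm (w' - w - \<beta> *\<^sub>R oja_field S w) \<le> d * \<beta>\<^sup>2" and d: "0 \<le> d"
  shows "expectation (\<lambda>\<omega>. (norm (chain (Suc n) \<omega> - w'))\<^sup>2)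
     \<le> (1 + 8 * K * \<beta>) * expectation (\<lambda>\<omega>. (norm (chain n \<omega> - w))\<^sup>2)
       + (4 * (3 * B\<^sup>2 + d) + (2 * B + 2 * K + 3 * B\<^sup>2 + d)\<^sup>2) * \<beta>\<^sup>2"
proof -
  define C where "C = (4 * (3 * B\<^sup>2 + d) + (2 * B + 2 * K + 3 * B\<^sup>2 + d)\<^sup>2) * \<beta>\<^sup>2"
  define D where "D \<omega> = chain n \<omega> - w" for \<omega>
  define F where "F \<omega> = oja_field (outer (X (Suc n) \<omega>) (X (Suc n) \<omega>)) (chain n \<omega>)" for \<omega>
  define G where "G = oja_field S w"
  note int = integrable_norm_chain_diff_squared[of n w, folded D_def] integrable_inner_chain_diff[of n w G, folded D_def]
    integrable_inner_sample_field[OF w(1), of n, folded D_def F_def]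
    integrable_inner_mean_field[OF w(1), of n, folded D_def]
  have "expectation (\<lambda>\<omega>. (norm (chain (Suc n) \<omega> - w'))\<^sup>2)
     \<le> expectation (\<lambda>\<omega>. (norm (D \<omega>))\<^sup>2 + 2 * \<beta> * (D \<omega> \<bullet> F \<omega> - D \<omega> \<bullet> G) + C)"
  proof (rule integral_mono_AE)
    show "AE \<omega> in M. (norm (chain (Suc n) \<omega> - w'))\<^sup>2 \<le> (norm (D \<omega>))\<^sup>2 + 2 * \<beta> * (D \<omega> \<bullet> F \<omega> - D \<omega> \<bullet> G) + C"
      using AE_norm_chain[of n] AE_chain_step[of n] sample_bound[of n]
    proof eventually_elim
      case (elim \<omega>)
      have "norm (F \<omega>) \<le> 2 * B" unfolding F_def
        by (rule oja_field_bound[OF norm_outer_mult_vec_le]) (use elim in auto)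
      moreover have "norm G \<le> 2 * K" unfolding G_def by (rule oja_field_bound[OF A w(1)])
      ultimately show ?case
        using norm_step_diff_squared_le[of "chain n \<omega>" w \<beta> "F \<omega>" "2 * B" G "2 * K" "chain (Suc n) \<omega>" "3 * B\<^sup>2" w' d]
          elim w stepsize ww' d
        by (simp add: C_def D_def F_def G_def inner_diff_right)
    qed
  qed (use int integrable_norm_chain_diff_squared in auto)
  also have "\<dots> = expectation (\<lambda>\<omega>. (norm (D \<omega>))\<^sup>2)
      + 2 * \<beta> * (expectation (\<lambda>\<omega>. D \<omega> \<bullet> F \<omega>) - expectation (\<lambda>\<omega>. D \<omega> \<bullet> G)) + C"
    using int by (simp add: prob_space)
  also have "expectation (\<lambda>\<omega>. D \<omega> \<bullet> F \<omega>) = expectation (\<lambda>\<omega>. D \<omega> \<bullet> oja_field S (chain n \<omega>))"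
    using expectation_inner_field[OF w(1), of n] by (simp add: D_def F_def)
  also have "\<dots> - expectation (\<lambda>\<omega>. D \<omega> \<bullet> G) = expectation (\<lambda>\<omega>. D \<omega> \<bullet> oja_field S (chain n \<omega>) - D \<omega> \<bullet> G)"
    using int by simp
  also have "\<dots> \<le> expectation (\<lambda>\<omega>. 4 * K * (norm (D \<omega>))\<^sup>2)"
  proof (rule integral_mono_AE)
    show "AE \<omega> in M. D \<omega> \<bullet> oja_field S (chain n \<omega>) - D \<omega> \<bullet> G \<le> 4 * K * (norm (D \<omega>))\<^sup>2"
      using AE_norm_chain[of n]
    proof eventually_elim
      case (elim \<omega>)
      have "D \<omega> \<bullet> oja_field S (chain n \<omega>) - D \<omega> \<bullet> G = D \<omega> \<bullet> (oja_field S (chain n \<omega>) - G)"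
        by (simp add: inner_diff_right)
      also have "\<dots> \<le> norm (D \<omega>) * norm (oja_field S (chain n \<omega>) - G)" by (rule norm_cauchy_schwarz)
      also have "\<dots> \<le> norm (D \<omega>) * (4 * K * norm (D \<omega>))"
        unfolding D_def G_def using oja_field_lipschitz[OF A elim w(1)] by (intro mult_left_mono) auto
      finally show ?case by (simp add: power2_eq_square mult_ac)
    qed
  qed (use int in auto)
  also have "\<dots> = 4 * K * expectation (\<lambda>\<omega>. (norm (D \<omega>))\<^sup>2)" by simp
  finally show ?thesis using stepsize
    by (simp add: C_def D_def algebra_simps)
qed

end

section \<open>Mean square distance between the chain and the flow\<close>

context oja_chain
begin

lemma expectation_grid_error:
  assumes S: "S = diag_mat l" and A: "\<And>x. norm (diag_mat l *v x) \<le> K * norm x" and K: "0 \<le> K" and V0: "norm V0 = 1"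
  shows "expectation (\<lambda>\<omega>. (norm (chain n \<omega> - oja_flow l V0 (\<beta> * n)))\<^sup>2)
     \<le> exp (8 * K * \<beta> * n) * (expectation (\<lambda>\<omega>. (norm (X 0 \<omega> - V0))\<^sup>2)
        + (4 * (3 * B\<^sup>2 + 8 * K\<^sup>2) + (2 * B + 2 * K + 3 * B\<^sup>2 + 8 * K\<^sup>2)\<^sup>2) * \<beta>\<^sup>2 * n)"
proof -
  define a where "a n = expectation (\<lambda>\<omega>. (norm (chain n \<omega> - oja_flow l V0 (\<beta> * real n)))\<^sup>2)" for n
  have V0': "V0 \<noteq> 0" using V0 by auto
  have "a n \<le> exp (8 * K * \<beta> * n) * (a 0
        + ((4 * (3 * B\<^sup>2 + 8 * K\<^sup>2) + (2 * B + 2 * K + 3 * B\<^sup>2 + 8 * K\<^sup>2)\<^sup>2) * \<beta>\<^sup>2) * n)"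
  proof (rule discrete_gronwall)
    fix n :: nat
    have "norm (oja_flow l V0 (\<beta> * n + \<beta>) - oja_flow l V0 (\<beta> * n) - \<beta> *\<^sub>R oja_field S (oja_flow l V0 (\<beta> * n)))
       \<le> (8 * K\<^sup>2) * \<beta>\<^sup>2"
      unfolding S using stepsize by (intro oja_flow_step A V0') auto
    moreover have "\<beta> * real (Suc n) = \<beta> * n + \<beta>" by (simp add: algebra_simps)
    ultimately show "a (Suc n) \<le> (1 + 8 * K * \<beta>) * a n
        + (4 * (3 * B\<^sup>2 + 8 * K\<^sup>2) + (2 * B + 2 * K + 3 * B\<^sup>2 + 8 * K\<^sup>2)\<^sup>2) * \<beta>\<^sup>2"
      unfolding a_def using A S by (intro expectation_step norm_oja_flow[OF V0']) auto
  qed (use stepsize K in \<open>auto simp: a_def\<close>)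
  then show ?thesis by (simp add: a_def chain_def oja_flow_0[OF V0])
qed

text \<open>\<open>t\<close> is not tied to multiples of \<beta>, because the final argument fixes
  its time grid before \<beta> tends to 0. Rounding \<open>t\<close> down costs
  \<open>2 * K * \<beta>\<close> along the flow, split off by (a + b)^2 \<le> 2 a^2 + 2 b^2.\<close>

lemma expectation_path_error:
  assumes S: "S = diag_mat l" and A: "\<And>x. norm (diag_mat l *v x) \<le> K * norm x" and K: "0 \<le> K" and V0: "norm V0 = 1"
    and t: "0 \<le> t"
  shows "expectation (\<lambda>\<omega>. (norm (step_path \<beta> (\<lambda>n. chain n \<omega>) t - oja_flow l V0 t))\<^sup>2)
     \<le> 2 * (exp (8 * K * t) * (expectation (\<lambda>\<omega>. (norm (X 0 \<omega> - V0))\<^sup>2)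
        + (4 * (3 * B\<^sup>2 + 8 * K\<^sup>2) + (2 * B + 2 * K + 3 * B\<^sup>2 + 8 * K\<^sup>2)\<^sup>2) * (\<beta> * t))) + 2 * (2 * K * \<beta>)\<^sup>2"
proof -
  define C where "C = 4 * (3 * B\<^sup>2 + 8 * K\<^sup>2) + (2 * B + 2 * K + 3 * B\<^sup>2 + 8 * K\<^sup>2)\<^sup>2"
  define e0 where "e0 = expectation (\<lambda>\<omega>. (norm (X 0 \<omega> - V0))\<^sup>2)"
  define n where "n = nat \<lfloor>t / \<beta>\<rfloor>"
  define w where "w = oja_flow l V0 (\<beta> * n)"
  have V0': "V0 \<noteq> 0" using V0 by auto
  have C: "0 \<le> C" by (simp add: C_def)
  have e0: "0 \<le> e0" by (simp add: e0_def)
  have "real n \<le> t / \<beta>" "t / \<beta> < real n + 1" unfolding n_def using t stepsize by simp_all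
  then have n: "\<beta> * n \<le> t" "t \<le> \<beta> * n + \<beta>" using stepsize by (simp_all add: field_simps)
  have "norm (w - oja_flow l V0 t) \<le> 2 * K * \<bar>\<beta> * n - t\<bar>"
    unfolding w_def by (rule oja_flow_lipschitz[OF A V0'])
  also have "\<dots> \<le> 2 * K * \<beta>" using n K by (intro mult_left_mono) auto
  finally have w: "norm (w - oja_flow l V0 t) \<le> 2 * K * \<beta>" .
  have "expectation (\<lambda>\<omega>. (norm (step_path \<beta> (\<lambda>n. chain n \<omega>) t - oja_flow l V0 t))\<^sup>2)
     \<le> expectation (\<lambda>\<omega>. 2 * (norm (chain n \<omega> - w))\<^sup>2 + 2 * (2 * K * \<beta>)\<^sup>2)"
  proof (rule integral_mono)
    fix \<omega>
    have "norm (chain n \<omega> - oja_flow l V0 t) \<le> norm (chain n \<omega> - w) + norm (w - oja_flow l V0 t)"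
      using norm_triangle_ineq[of "chain n \<omega> - w" "w - oja_flow l V0 t"] by simp
    then have "norm (chain n \<omega> - oja_flow l V0 t) \<le> norm (chain n \<omega> - w) + 2 * K * \<beta>" using w by simp
    then have "(norm (chain n \<omega> - oja_flow l V0 t))\<^sup>2 \<le> (norm (chain n \<omega> - w) + 2 * K * \<beta>)\<^sup>2"
      by (intro power_mono) auto
    also have "\<dots> \<le> 2 * (norm (chain n \<omega> - w))\<^sup>2 + 2 * (2 * K * \<beta>)\<^sup>2"
      using sum_squares_bound[of "norm (chain n \<omega> - w)" "2 * K * \<beta>"] by (simp add: power2_sum)
    finally show "(norm (step_path \<beta> (\<lambda>n. chain n \<omega>) t - oja_flow l V0 t))\<^sup>2
       \<le> 2 * (norm (chain n \<omega> - w))\<^sup>2 + 2 * (2 * K * \<beta>)\<^sup>2"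
      using t by (simp add: step_path_def n_def)
  next
    show "integrable M (\<lambda>\<omega>. (norm (step_path \<beta> (\<lambda>n. chain n \<omega>) t - oja_flow l V0 t))\<^sup>2)"
      using t by (simp add: step_path_def integrable_norm_chain_diff_squared)
  qed (simp add: integrable_norm_chain_diff_squared)
  also have "\<dots> = 2 * expectation (\<lambda>\<omega>. (norm (chain n \<omega> - w))\<^sup>2) + 2 * (2 * K * \<beta>)\<^sup>2"
    by (simp add: integrable_norm_chain_diff_squared prob_space)
  also have "expectation (\<lambda>\<omega>. (norm (chain n \<omega> - w))\<^sup>2) \<le> exp (8 * K * (\<beta> * n)) * (e0 + C * (\<beta> * (\<beta> * n)))"
    using expectation_grid_error[OF S A K V0, of n]
    by (simp add: w_def e0_def C_def power2_eq_square mult.assoc)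
  also have "\<dots> \<le> exp (8 * K * t) * (e0 + C * (\<beta> * t))"
    using n(1) mult_left_mono[OF n(1) K] stepsize C e0 by (intro mult_mono add_mono mult_left_mono) auto
  finally show ?thesis by (simp add: e0_def C_def)
qed

end

text \<open>\<open>b\<close> is the jump slack of \<open>x\<close>, in use the stepsize. The mesh
  \<open>h\<close> can be chosen independently of it, so the number of grid points need not grow as
  the stepsize tends to 0.\<close>

lemma dist_le_grid:
  fixes x y :: "real \<Rightarrow> 'a::metric_space"
  assumes h: "0 < h"
    and x: "\<And>s t. 0 \<le> s \<Longrightarrow> s \<le> t \<Longrightarrow> dist (x s) (x t) \<le> L * (t - s + b)" and L: "0 \<le> L"
    and y: "\<And>s t. dist (y s) (y t) \<le> L' * \<bar>s - t\<bar>" and L': "0 \<le> L'"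
    and grid: "\<And>j. j \<le> nat \<lfloor>T / h\<rfloor> \<Longrightarrow> dist (x (j * h)) (y (j * h)) \<le> \<rho>"
    and t: "0 \<le> t" "t \<le> T"
  shows "dist (x t) (y t) \<le> \<rho> + L * (h + b) + L' * h"
proof -
  define j where "j = nat \<lfloor>t / h\<rfloor>"
  have "real j \<le> t / h" "t / h < real j + 1" unfolding j_def using t h by simp_all
  then have jh: "j * h \<le> t" "t \<le> j * h + h" using h by (simp_all add: field_simps)
  have "j \<le> nat \<lfloor>T / h\<rfloor>" unfolding j_def using t h by (intro nat_mono floor_mono divide_right_mono) auto
  then have "dist (x (j * h)) (y (j * h)) \<le> \<rho>" by (rule grid)
  moreover have "dist (x (j * h)) (x t) \<le> L * (h + b)"
    using x[of "j * h" t] jh h L by (intro order_trans[OF x] mult_left_mono) auto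
  moreover have "dist (y (j * h)) (y t) \<le> L' * h"
    using jh L' by (intro order_trans[OF y] mult_left_mono) auto
  moreover have "dist (x t) (y t) \<le> dist (x (j * h)) (x t) + dist (x (j * h)) (y (j * h)) + dist (y (j * h)) (y t)"
    by (smt (verit) dist_commute dist_triangle)
  ultimately show ?thesis by linarith
qed

text \<open>Convergence to a constant only needs \<open>skorokhod_dist L (X i)\<close> to be small off a set that
  carries little of the mass of a dominating variable \<open>S i\<close>; this avoids any measurability
  question for the distance itself.\<close>

lemma (in prob_space) converges_weakly_skorokhod_constI:
  fixes X :: "'i \<Rightarrow> 'a \<Rightarrow> real \<Rightarrow> 'b::metric_space"
  assumes X: "\<forall>\<^sub>F i in F. X i \<in> measurable M (borel_of skorokhod_topology)" and L: "L \<in> cadlag"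
    and S: "\<And>r. 0 < r \<Longrightarrow> \<exists>S g. (g \<longlongrightarrow> (0::real)) F \<and> (\<forall>\<^sub>F i in F. integrable M (S i) \<and> expectation (S i) \<le> g i \<and>
        (AE \<omega> in M. 0 \<le> S i \<omega> \<and> (S i \<omega> < 1 \<longrightarrow> skorokhod_dist L (X i \<omega>) < r)))"
  shows "converges_weakly M skorokhod_topology X (\<lambda>_. L) F"
  unfolding converges_weakly_def
proof (intro conjI allI impI X)
  show "(\<lambda>_. L) \<in> measurable M (borel_of skorokhod_topology)"
    using L by (simp add: space_borel_of topspace_skorokhod_topology)
next
  fix f :: "(real \<Rightarrow> 'b) \<Rightarrow> real"
  assume "continuous_map skorokhod_topology euclideanreal f \<and> bounded (f ` topspace skorokhod_topology)"
  then have f: "continuous_map skorokhod_topology euclideanreal f" and "bounded (f ` cadlag)"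
    by (auto simp: topspace_skorokhod_topology)
  then obtain K where K: "\<And>y. y \<in> cadlag \<Longrightarrow> \<bar>f y\<bar> \<le> K" by (auto simp: bounded_iff)
  have K0: "0 \<le> K" using K[OF L] by linarith
  have fm: "f \<in> borel_measurable (borel_of skorokhod_topology)" by (rule borel_measurable_continuous_map[OF f])
  show "((\<lambda>i. expectation (\<lambda>\<omega>. f (X i \<omega>))) \<longlongrightarrow> expectation (\<lambda>\<omega>. f L)) F"
  proof (rule tendstoI)
    fix e :: real assume e: "0 < e"
    define O' where "O' = {y \<in> topspace skorokhod_topology. f y \<in> ball (f L) (e / 2)}"
    have "openin skorokhod_topology O'" unfolding O'_def by (rule openin_continuous_map_preimage[OF f]) simp
    moreover have "L \<in> O'" using L e by (simp add: O'_def topspace_skorokhod_topology)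
    ultimately obtain r where r: "0 < r" "\<And>y. y \<in> cadlag \<Longrightarrow> skorokhod_dist L y < r \<Longrightarrow> y \<in> O'"
      unfolding openin_skorokhod_topology by blast
    obtain S g where g: "(g \<longlongrightarrow> (0::real)) F" and S: "\<forall>\<^sub>F i in F. integrable M (S i) \<and> expectation (S i) \<le> g i \<and>
        (AE \<omega> in M. 0 \<le> S i \<omega> \<and> (S i \<omega> < 1 \<longrightarrow> skorokhod_dist L (X i \<omega>) < r))"
      using assms(3)[OF r(1)] by blast
    have "((\<lambda>i. 2 * K * g i) \<longlongrightarrow> 2 * K * 0) F" by (intro tendsto_intros g)
    then have "\<forall>\<^sub>F i in F. 2 * K * g i < e / 2" using e by (intro order_tendstoD) auto
    then show "\<forall>\<^sub>F i in F. dist (expectation (\<lambda>\<omega>. f (X i \<omega>))) (expectation (\<lambda>\<omega>. f L)) < e"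
      using S X
    proof eventually_elim
      case (elim i)
      have Xc: "X i \<omega> \<in> cadlag" if "\<omega> \<in> space M" for \<omega>
        using measurable_space[OF elim(3) that] by (simp add: space_borel_of topspace_skorokhod_topology)
      have fX: "integrable M (\<lambda>\<omega>. f (X i \<omega>))"
        using K Xc by (intro integrable_const_bound[where B = K] measurable_compose[OF elim(3) fm]) auto
      have Si: "integrable M (S i)" using elim by simp
      have "\<bar>expectation (\<lambda>\<omega>. f (X i \<omega>)) - expectation (\<lambda>\<omega>. f L)\<bar> = \<bar>expectation (\<lambda>\<omega>. f (X i \<omega>) - f L)\<bar>"
        using fX by simp
      also have "\<dots> \<le> expectation (\<lambda>\<omega>. \<bar>f (X i \<omega>) - f L\<bar>)" by (rule integral_abs_bound)
      \<comment> \<open>Markov's inequality in pointwise form: where \<open>S i \<omega> < 1\<close>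
        the path lies in \<open>O'\<close>, and elsewhere the trivial bound \<open>2 * K\<close> is
        at most \<open>2 * K * S i \<omega>\<close>.\<close>
      also have "\<dots> \<le> expectation (\<lambda>\<omega>. e / 2 + 2 * K * S i \<omega>)"
      proof (rule integral_mono_AE)
        have "AE \<omega> in M. 0 \<le> S i \<omega> \<and> (S i \<omega> < 1 \<longrightarrow> skorokhod_dist L (X i \<omega>) < r)" using elim by simp
        then show "AE \<omega> in M. \<bar>f (X i \<omega>) - f L\<bar> \<le> e / 2 + 2 * K * S i \<omega>"
          using AE_space
        proof eventually_elim
          case (elim \<omega>)
          show ?case
          proof (cases "S i \<omega> < 1")
            case True
            then have "X i \<omega> \<in> O'" using elim r(2) Xc by blast
            then have "\<bar>f (X i \<omega>) - f L\<bar> \<le> e / 2" by (simp add: O'_def dist_real_def abs_minus_commute)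
            moreover have "0 \<le> 2 * K * S i \<omega>" using K0 elim by simp
            ultimately show ?thesis by linarith
          next
            case False
            then have "2 * K * 1 \<le> 2 * K * S i \<omega>" using K0 by (intro mult_left_mono) auto
            then show ?thesis using K[OF L] K[OF Xc[OF elim(2)]] e by linarith
          qed
        qed
      qed (use fX Si in auto)
      also have "\<dots> = e / 2 + 2 * K * expectation (S i)" using Si by (simp add: prob_space)
      also have "\<dots> \<le> e / 2 + 2 * K * g i" using elim K0 by (intro add_left_mono mult_left_mono) auto
      also have "\<dots> < e" using elim by simp
      finally show ?case by (simp add: dist_real_def)
    qed
  qed
qed

text \<open>Merges the two independence hypotheses of the theorem into the one that
  \<open>oja_chain\<close> needs. In a finite intersection the factor at index 0 splits off by
  independence from the whole sequence; the others factorise by independence within it.\<close>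

lemma (in prob_space) indep_vars_prepend:
  fixes Z :: "nat \<Rightarrow> 'a \<Rightarrow> 'b"
  assumes Z: "indep_vars (\<lambda>_. N) Z UNIV"
    and x: "indep_elements N x (PiM {1..} (\<lambda>_. N)) (\<lambda>\<omega>. \<lambda>n\<in>{1..}. Z n \<omega>)"
  shows "indep_vars (\<lambda>_. N) (\<lambda>n. if n = 0 then x else Z n) UNIV"
proof -
  define Y where "Y = (\<lambda>n. if n = 0 then x else Z n)"
  let ?G = "\<lambda>i. {Y i -` A \<inter> space M | A. A \<in> sets N}"
  have xm: "x \<in> measurable M N" and Zm: "\<And>n. Z n \<in> measurable M N"
    and ind: "indep_set (sets (vimage_algebra (space M) x N))
      (sets (vimage_algebra (space M) (\<lambda>\<omega>. \<lambda>n\<in>{1..}. Z n \<omega>) (PiM {1..} (\<lambda>_. N))))"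
    using assms by (auto simp: indep_elements_def indep_vars_def)
  have Ym: "Y n \<in> measurable M N" for n using xm Zm by (simp add: Y_def)
  have Zi: "indep_sets (\<lambda>i. {Z i -` A \<inter> space M | A. A \<in> sets N}) UNIV"
    using Z by (simp add: indep_vars_def2)
  have pos: "prob (\<Inter>j\<in>J. A j) = (\<Prod>j\<in>J. prob (A j))"
    if "finite J" "J \<noteq> {}" "0 \<notin> J" "\<forall>j\<in>J. A j \<in> ?G j" for A J
  proof (rule indep_setsD[OF Zi])
    show "\<forall>j\<in>J. A j \<in> {Z j -` A \<inter> space M | A. A \<in> sets N}"
      using that by (auto simp: Y_def split: if_splits)
  qed (use that in auto)
  have "indep_sets ?G UNIV"
  proof (rule indep_setsI)
    show "?G i \<subseteq> events" for i using Ym by (auto intro: measurable_sets)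
  next
    fix A J assume J: "J \<noteq> {}" "J \<subseteq> UNIV" "finite J" and A: "\<forall>j\<in>J. A j \<in> ?G j"
    show "prob (\<Inter>j\<in>J. A j) = (\<Prod>j\<in>J. prob (A j))"
    proof (cases "0 \<in> J")
      case False then show ?thesis using J A by (intro pos) auto
    next
      case True
      define J' where "J' = J - {0}"
      have JJ: "J = insert 0 J'" "0 \<notin> J'" "finite J'" using True J by (auto simp: J'_def)
      show ?thesis
      \<comment> \<open>The intersection over an empty \<open>J'\<close> would be
        \<open>UNIV\<close> instead of an event in \<open>space M\<close>.\<close>
      proof (cases "J' = {}")
        case True then show ?thesis using JJ by simp
      next
        case False
        have "\<forall>j\<in>J'. \<exists>C. C \<in> sets N \<and> A j = Z j -` C \<inter> space M"
          using A JJ by (auto simp: Y_def split: if_splits)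
        then obtain C where C: "\<And>j. j \<in> J' \<Longrightarrow> C j \<in> sets N \<and> A j = Z j -` C j \<inter> space M" by metis
        \<comment> \<open>A finite cylinder: it exhibits the joint event of the indices in
          \<open>J'\<close> as an event of the whole sequence.\<close>
        define D where "D = {z \<in> space (PiM {1..} (\<lambda>_. N)). \<forall>j\<in>J'. z j \<in> C j}"
        have "D \<in> sets (PiM {1..} (\<lambda>_. N))"
          unfolding D_def
        proof (rule sets.sets_Collect_finite_All[OF _ JJ(3)])
          fix j assume j: "j \<in> J'"
          then have "j \<in> {1..}" using JJ(2) by (cases j) auto
          then show "{z \<in> space (PiM {1..} (\<lambda>_. N)). z j \<in> C j} \<in> sets (PiM {1..} (\<lambda>_. N))"
            using measurable_sets[OF measurable_component_singleton[of j "{1..}" "\<lambda>_. N"], of "C j"] C[OF j]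
            by (simp add: vimage_def Int_def conj_commute)
        qed
        moreover have "(\<lambda>\<omega>. \<lambda>n\<in>{1..}. Z n \<omega>) -` D \<inter> space M = (\<Inter>j\<in>J'. A j)"
        proof -
          have "j \<ge> 1" if "j \<in> J'" for j using that JJ(2) by (cases j) auto
          moreover have "(\<lambda>n\<in>{1..}. Z n \<omega>) \<in> space (PiM {1..} (\<lambda>_. N))" if "\<omega> \<in> space M" for \<omega>
            using measurable_space[OF Zm that] by (auto simp: space_PiM)
          ultimately show ?thesis using C False by (auto simp: D_def)
        qed
        ultimately have "(\<Inter>j\<in>J'. A j) \<in> sets (vimage_algebra (space M) (\<lambda>\<omega>. \<lambda>n\<in>{1..}. Z n \<omega>) (PiM {1..} (\<lambda>_. N)))"
          using in_vimage_algebra by metis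
        moreover have "A 0 \<in> sets (vimage_algebra (space M) x N)"
          using A JJ by (auto simp: Y_def intro: in_vimage_algebra)
        ultimately have "prob (A 0 \<inter> (\<Inter>j\<in>J'. A j)) = prob (A 0) * prob (\<Inter>j\<in>J'. A j)"
          by (intro indep_setD[OF ind])
        also have "prob (\<Inter>j\<in>J'. A j) = (\<Prod>j\<in>J'. prob (A j))"
          using JJ A False by (intro pos) auto
        finally show ?thesis using JJ by simp
      qed
    qed
  qed
  then have "indep_vars (\<lambda>_. N) Y UNIV" using Ym by (simp add: indep_vars_def2)
  then show ?thesis by (simp only: Y_def)
qed

section \<open>Rotation to the eigenbasis\<close>

lemma norm_outer: "norm (outer x y) = norm (x :: real ^ ('n::finite)) * norm (y :: real ^ 'n)"
proof -
  have "outer x y $ i = x $ i *\<^sub>R y" for i by (simp add: outer_def vec_eq_iff)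
  then have "norm (outer x y) = L2_set (\<lambda>i. norm (x $ i) * norm y) UNIV" by (simp add: norm_vec_def[of "outer x y"])
  also have "\<dots> = norm x * norm y" by (simp add: norm_vec_def[of x] L2_set_left_distrib)
  finally show ?thesis .
qed

lemma borel_measurable_outer_self [measurable]: "(\<lambda>z :: real ^ ('n::finite). outer z z) \<in> borel_measurable borel"
  unfolding outer_def by (intro borel_measurable_continuous_onI continuous_intros)

lemma conjugate_outer_component:
  fixes U :: "real ^ ('n::finite) ^ 'n"
  shows "(transpose U ** outer z z ** U) $ i $ j = (transpose U *v z) $ i * (transpose U *v z) $ j"
  by (simp add: matrix_matrix_mult_def matrix_vector_mult_def transpose_def outer_def sum_distrib_left sum_distrib_right
      mult_ac)

lemma linear_conjugate_component:
  fixes U :: "real ^ ('n::finite) ^ 'n"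
  shows "linear (\<lambda>A. (transpose U ** A ** U) $ i $ j)"
  by (rule linearI) (simp_all add: matrix_matrix_mult_def sum.distrib sum_distrib_left sum_distrib_right algebra_simps)

lemma norm_orthogonal_transpose_mult:
  fixes U :: "real ^ ('n::finite) ^ 'n"
  assumes "orthogonal_matrix U" shows "norm (transpose U *v z) = norm z"
proof -
  have "orthogonal_transformation ((*v) (transpose U))"
    using assms by (simp add: orthogonal_transformation_matrix orthogonal_matrix_transpose)
  then show ?thesis by (rule orthogonal_transformation_norm)
qed

subsection \<open>Convergence\<close>

theorem theorem3p1:
  fixes M :: "'w measure"
    and Z :: "nat \<Rightarrow> 'w \<Rightarrow> real ^ ('n :: {finite, linorder})"
    and U :: "real ^ ('n :: {finite, linorder}) ^ ('n :: {finite, linorder})"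
    and lam :: "('n :: {finite, linorder}) \<Rightarrow> real"
    and B :: real
    and v0 :: "real \<Rightarrow> 'w \<Rightarrow> real ^ ('n :: {finite, linorder})"
    and V0 :: "real ^ ('n :: {finite, linorder})"
  assumes "prob_space M"
    and "CARD('n :: {finite, linorder}) \<ge> 2"
    and "prob_space.indep_vars M (\<lambda>_. borel) Z UNIV"
    and "\<And>n. distr M borel (Z n) = distr M borel (Z 0)"
    and "(LINT \<omega>|M. Z 0 \<omega>) = 0"
    and "orthogonal_matrix U"
    and "(LINT \<omega>|M. outer (Z 0 \<omega>) (Z 0 \<omega>)) = U ** diag_mat lam ** transpose U"
    and "\<And>i j. i \<le> j \<Longrightarrow> lam j \<le> lam i"
    and "\<And>i. i \<noteq> Min UNIV \<Longrightarrow> lam i < lam (Min UNIV)"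
    and "\<And>i. 0 < lam i"
    and "AE \<omega> in M. (norm (Z 0 \<omega>))\<^sup>2 \<le> B"
    and "\<And>\<beta>. \<beta> > 0 \<Longrightarrow> AE \<omega> in M. v0 \<beta> \<omega> \<in> sphere 0 1"
    and "\<And>\<beta>. \<beta> > 0 \<Longrightarrow> prob_space.indep_elements M borel (v0 \<beta>)
           (PiM {1..} (\<lambda>_. borel)) (\<lambda>\<omega>. \<lambda>n\<in>{1..}. Z n \<omega>)"
    and "V0 \<in> sphere 0 1"
    and "converges_weakly M euclidean v0 (\<lambda>_. V0) (at_right 0)"
  shows "\<exists>V. oja_ode_solution lam V0 V \<and>
           (\<forall>W. oja_ode_solution lam V0 W \<longrightarrow> (\<forall>t\<ge>0. W t = V t)) \<and>
           converges_weakly M skorokhod_topology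
             (\<lambda>\<beta> \<omega>. \<lambda>t\<in>{0..}. oja \<beta> (\<lambda>n. transpose U *v Z n \<omega>) (v0 \<beta> \<omega>) (nat \<lfloor>t / \<beta>\<rfloor>))
             (\<lambda>_. \<lambda>t\<in>{0..}. V t) (at_right 0)"
proof -
  interpret prob_space M by fact
  have V0: "norm V0 = 1" using assms(14) by simp
  then have V0': "V0 \<noteq> 0" by auto
  define K where "K = onorm ((*v) (diag_mat lam))"
  have K: "norm (diag_mat lam *v x) \<le> K * norm x" for x unfolding K_def by (rule norm_matrix_vector_mult_le)
  have K0: "0 \<le> K" unfolding K_def by (rule onorm_pos_le) (rule matrix_vector_mul_bounded_linear)
  have Zm [measurable]: "Z n \<in> borel_measurable M" for n using assms(3) by (simp add: indep_vars_def)
  have ZB: "AE \<omega> in M. (norm (Z n \<omega>))\<^sup>2 \<le> B" for n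
  proof -
    have "AE z in distr M borel (Z 0). (norm z)\<^sup>2 \<le> B" using assms(11) by (subst AE_distr_iff) auto
    then have "AE z in distr M borel (Z n). (norm z)\<^sup>2 \<le> B" by (simp only: assms(4)[of n])
    then show ?thesis by (subst (asm) AE_distr_iff) auto
  qed
  \<comment> \<open>An entry of the conjugated matrix is a bounded linear functional, so it passes
    through the matrix-valued integral; orthogonality then cancels \<open>U\<close>. Equality in law
    carries the result from \<open>Z 0\<close> to \<open>Z n\<close>.\<close>
  have moment: "expectation (\<lambda>\<omega>. (transpose U *v Z n \<omega>) $ i * (transpose U *v Z n \<omega>) $ j) = diag_mat lam $ i $ j" for n i j
  proof -
    define q where "q z = (transpose U ** outer z z ** U) $ i $ j" for z
    have L: "bounded_linear (\<lambda>A. (transpose U ** A ** U) $ i $ j)"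
      using linear_conjugate_component by (simp add: linear_conv_bounded_linear)
    have qm: "q \<in> borel_measurable borel"
      unfolding q_def by (rule measurable_compose[OF borel_measurable_outer_self borel_measurable_continuous_onI])
        (intro linear_continuous_on L)
    have "integrable M (\<lambda>\<omega>. outer (Z 0 \<omega>) (Z 0 \<omega>))"
    proof (rule integrable_const_bound[where B = B])
      show "AE \<omega> in M. norm (outer (Z 0 \<omega>) (Z 0 \<omega>)) \<le> B"
        using assms(11) by (simp add: norm_outer power2_eq_square)
    qed simp
    then have "expectation (\<lambda>\<omega>. q (Z 0 \<omega>)) = (transpose U ** (U ** diag_mat lam ** transpose U) ** U) $ i $ j"
      unfolding q_def assms(7)[symmetric] by (rule integral_bounded_linear[OF L])
    also have "transpose U ** (U ** diag_mat lam ** transpose U) ** U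
        = (transpose U ** U) ** diag_mat lam ** (transpose U ** U)"
      by (simp add: matrix_mul_assoc)
    also have "\<dots> = diag_mat lam" using assms(6) by (simp add: orthogonal_matrix)
    finally have "expectation (\<lambda>\<omega>. q (Z 0 \<omega>)) = diag_mat lam $ i $ j" .
    moreover have "expectation (\<lambda>\<omega>. q (Z n \<omega>)) = expectation (\<lambda>\<omega>. q (Z 0 \<omega>))"
      using integral_distr[OF Zm qm, of n] integral_distr[OF Zm qm, of 0] assms(4)[of n] by simp
    ultimately show ?thesis by (simp add: q_def conjugate_outer_component)
  qed
  \<comment> \<open>Index 0 is taken over by the initial vector. The first sample is
    \<open>Z 1\<close>, while \<open>Z 0\<close> is the generic copy for which the moment and bound
    assumptions are stated.\<close>
  define X where "X \<beta> n = (\<lambda>\<omega>. if n = 0 then v0 \<beta> \<omega> else transpose U *v Z n \<omega>)" for \<beta> and n :: nat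
  have Ux: "continuous_on UNIV ((*v) (transpose U))"
    by (intro linear_continuous_on matrix_vector_mul_bounded_linear)
  have chain: "oja_chain M (X \<beta>) (diag_mat lam) B \<beta>" if b: "0 < \<beta>" "\<beta> \<le> 1" for \<beta>
  proof
    have "indep_vars (\<lambda>_. borel) (\<lambda>n \<omega>. (if n = 0 then \<lambda>z. z else (*v) (transpose U)) ((if n = 0 then v0 \<beta> else Z n) \<omega>)) UNIV"
      by (rule indep_vars_compose2[OF indep_vars_prepend[OF assms(3) assms(13)[OF b(1)]]])
        (auto intro: borel_measurable_continuous_onI Ux)
    moreover have "(\<lambda>n \<omega>. (if n = 0 then \<lambda>z. z else (*v) (transpose U)) ((if n = 0 then v0 \<beta> else Z n) \<omega>)) = X \<beta>"
      by (auto simp: X_def fun_eq_iff)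
    ultimately show "indep_vars (\<lambda>_. borel) (X \<beta>) UNIV" by (simp only:)
    show "AE \<omega> in M. norm (X \<beta> 0 \<omega>) = 1" using assms(12)[OF b(1)] by (simp add: X_def)
    show "AE \<omega> in M. (norm (X \<beta> (Suc n) \<omega>))\<^sup>2 \<le> B" for n
      using ZB[of "Suc n"] by (simp add: X_def norm_orthogonal_transpose_mult[OF assms(6)] del: transpose_matrix_vector)
    show "expectation (\<lambda>\<omega>. X \<beta> (Suc n) \<omega> $ i * X \<beta> (Suc n) \<omega> $ j) = diag_mat lam $ i $ j" for n i j
      using moment by (simp add: X_def)
  qed (use b in auto)
  have B0: "0 \<le> B" using oja_chain.bound_nonneg[OF chain[of 1]] by simp
  define x where "x \<beta> \<omega> = step_path \<beta> (oja \<beta> (\<lambda>n. X \<beta> n \<omega>) (X \<beta> 0 \<omega>))" for \<beta> \<omega>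
  have small: "\<forall>\<^sub>F \<beta> in at_right 0. 0 < \<beta> \<and> \<beta> \<le> c" if "0 < c" for c :: real
    using that by (auto simp: eventually_at_right_field intro!: exI[of _ c])
  define V where "V = oja_flow lam V0"
  have V_lip: "dist (V s) (V t) \<le> 2 * K * \<bar>s - t\<bar>" for s t
    unfolding V_def dist_norm by (rule oja_flow_lipschitz[OF K V0'])
  define e where "e \<beta> = expectation (\<lambda>\<omega>. (norm (v0 \<beta> \<omega> - V0))\<^sup>2)" for \<beta>
  have e: "(e \<longlongrightarrow> 0) (at_right 0)"
  proof -
    \<comment> \<open>Truncation makes the squared distance an admissible bounded test function. It
      is almost surely inactive along \<open>v0 \<beta>\<close>: two points of the sphere are at
      distance at most 2.\<close>
    define f where "f z = min ((norm (z - V0))\<^sup>2) 4" for z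
    have "continuous_map euclidean euclideanreal f"
      unfolding f_def continuous_map_iff_continuous2 by (intro continuous_intros)
    moreover have "bounded (range f)"
      unfolding bounded_iff by (rule exI[of _ 4]) (auto simp: f_def)
    ultimately have "((\<lambda>\<beta>. expectation (\<lambda>\<omega>. f (v0 \<beta> \<omega>))) \<longlongrightarrow> expectation (\<lambda>\<omega>. f V0)) (at_right 0)"
      using assms(15) by (simp add: converges_weakly_def)
    then have "((\<lambda>\<beta>. expectation (\<lambda>\<omega>. f (v0 \<beta> \<omega>))) \<longlongrightarrow> 0) (at_right 0)" by (simp add: f_def)
    moreover have "\<forall>\<^sub>F \<beta> in at_right 0. expectation (\<lambda>\<omega>. f (v0 \<beta> \<omega>)) = e \<beta>"
      using small[OF zero_less_one]
    proof eventually_elim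
      case (elim \<beta>)
      have [measurable]: "v0 \<beta> \<in> borel_measurable M"
        using assms(13)[of \<beta>] elim by (simp add: indep_elements_def)
      show ?case unfolding e_def
      proof (rule integral_cong_AE)
        show "AE \<omega> in M. f (v0 \<beta> \<omega>) = (norm (v0 \<beta> \<omega> - V0))\<^sup>2"
          using assms(12)[OF conjunct1[OF elim]]
        proof eventually_elim
          case (elim \<omega>)
          then have "norm (v0 \<beta> \<omega> - V0) \<le> 2" using norm_triangle_ineq4[of "v0 \<beta> \<omega>" V0] V0 by simp
          then have "(norm (v0 \<beta> \<omega> - V0))\<^sup>2 \<le> 2\<^sup>2" by (intro power_mono) auto
          then show ?case by (simp add: f_def)
        qed
      qed (simp_all add: f_def)
    qed
    ultimately show ?thesis using tendsto_cong by force
  qed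
  define C where "C = 4 * (3 * B\<^sup>2 + 8 * K\<^sup>2) + (2 * B + 2 * K + 3 * B\<^sup>2 + 8 * K\<^sup>2)\<^sup>2"
  define g where "g t \<beta> = 2 * (exp (8 * K * t) * (e \<beta> + C * (\<beta> * t))) + 2 * (2 * K * \<beta>)\<^sup>2" for t \<beta>
  have g: "(g t \<longlongrightarrow> 0) (at_right 0)" for t
  proof -
    have "(g t \<longlongrightarrow> 2 * (exp (8 * K * t) * (0 + C * (0 * t))) + 2 * (2 * K * 0)\<^sup>2) (at_right 0)"
      unfolding g_def[abs_def] by (intro tendsto_intros e)
    then show ?thesis by simp
  qed
  define L where "L = 2 * B + 3 * B\<^sup>2"
  have L0: "0 \<le> L" using B0 by (simp add: L_def)
  have "converges_weakly M skorokhod_topology x (\<lambda>_. \<lambda>t\<in>{0..}. V t) (at_right 0)"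
  proof (rule converges_weakly_skorokhod_constI)
    show "\<forall>\<^sub>F \<beta> in at_right 0. x \<beta> \<in> measurable M (borel_of skorokhod_topology)"
      using small[OF zero_less_one]
    proof eventually_elim
      case (elim \<beta>)
      then interpret oja_chain M "X \<beta>" "diag_mat lam" B \<beta> by (intro chain) auto
      have "x \<beta> = (\<lambda>\<omega>. step_path \<beta> (\<lambda>n. chain n \<omega>))" by (simp add: x_def chain_def fun_eq_iff)
      then show ?case using elim by (simp add: measurable_step_path)
    qed
    show "(\<lambda>t\<in>{0..}. V t) \<in> cadlag"
      unfolding V_def using has_vector_derivative_oja_flow[OF V0']
      by (intro continuous_path_cadlag) (blast intro: has_vector_derivative_continuous)
  next
    fix r :: real assume r: "0 < r"
    have "((\<lambda>T::real. exp (- T)) \<longlongrightarrow> 0) at_top"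
      by (intro filterlim_compose[OF exp_at_bot] filterlim_uminus_at_bot_at_top)
    then have "\<forall>\<^sub>F T in at_top. exp (- T) < r / 2 \<and> (0::real) \<le> T"
      using r eventually_ge_at_top[of 0] by (auto intro!: eventually_conj dest: order_tendstoD(2)[where a = "r / 2"])
    then obtain T :: real where T: "exp (- T) < r / 2" "0 \<le> T" by (auto dest: eventually_happens)
    \<comment> \<open>The error budget: for \<open>\<beta> \<le> h\<close>, the bound
      \<open>\<rho> + L * (h + \<beta>) + 2 * K * h\<close> is at most five sixteenths of
      \<open>r\<close>, below \<open>r / 2\<close>. The summand 1 keeps the denominator
      positive.\<close>
    define h where "h = r / (16 * (L + K + 1))"
    have h: "0 < h" using r L0 K0 by (simp add: h_def)
    have hr: "L * h \<le> r / 16" "K * h \<le> r / 16"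
      using r L0 K0 by (simp_all add: h_def field_simps)
    define \<rho> where "\<rho> = r / 16"
    have \<rho>: "0 < \<rho>" using r by (simp add: \<rho>_def)
    define J where "J = {..nat \<lfloor>T / h\<rfloor>}"
    \<comment> \<open>Scaled so that \<open>S \<beta> \<omega> < 1\<close> forces every grid error
      to be at most \<rho>; the union bound over the grid is contained in the sum.\<close>
    define S where "S \<beta> \<omega> = (\<Sum>j\<in>J. (norm (x \<beta> \<omega> (j * h) - V (j * h)))\<^sup>2) / \<rho>\<^sup>2" for \<beta> \<omega>
    define G where "G \<beta> = (\<Sum>j\<in>J. g (j * h) \<beta>) / \<rho>\<^sup>2" for \<beta>
    have "(G \<longlongrightarrow> (\<Sum>j\<in>J. 0) / \<rho>\<^sup>2) (at_right 0)"
      unfolding G_def[abs_def] using \<rho> by (intro tendsto_intros g) auto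
    then have G: "(G \<longlongrightarrow> 0) (at_right 0)" by simp
    have "\<forall>\<^sub>F \<beta> in at_right 0. integrable M (S \<beta>) \<and> expectation (S \<beta>) \<le> G \<beta> \<and>
        (AE \<omega> in M. 0 \<le> S \<beta> \<omega> \<and> (S \<beta> \<omega> < 1 \<longrightarrow> skorokhod_dist (\<lambda>t\<in>{0..}. V t) (x \<beta> \<omega>) < r))"
      using small[OF zero_less_one] small[OF h]
    proof eventually_elim
      case (elim \<beta>)
      then interpret oja_chain M "X \<beta>" "diag_mat lam" B \<beta> by (intro chain) auto
      have x: "x \<beta> \<omega> = step_path \<beta> (\<lambda>n. chain n \<omega>)" for \<omega> by (simp add: x_def chain_def)
      have int: "integrable M (\<lambda>\<omega>. (norm (x \<beta> \<omega> (real j * h) - V (real j * h)))\<^sup>2)" for j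
        using h by (simp add: x step_path_def integrable_norm_chain_diff_squared)
      have "expectation (\<lambda>\<omega>. (norm (x \<beta> \<omega> (real j * h) - V (real j * h)))\<^sup>2) \<le> g (real j * h) \<beta>" for j
        using expectation_path_error[OF refl K K0 V0, of "real j * h"] h
        by (simp add: x V_def g_def C_def e_def X_def)
      then have "expectation (S \<beta>) \<le> G \<beta>"
        unfolding S_def[abs_def] G_def using int by (simp add: Bochner_Integration.integral_sum divide_right_mono sum_mono)
      moreover have "integrable M (S \<beta>)" unfolding S_def[abs_def] using int by simp
      moreover have "AE \<omega> in M. 0 \<le> S \<beta> \<omega> \<and> (S \<beta> \<omega> < 1 \<longrightarrow> skorokhod_dist (\<lambda>t\<in>{0..}. V t) (x \<beta> \<omega>) < r)"
        using AE_chain_increment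
      proof (eventually_elim, intro conjI impI)
        fix \<omega> assume inc: "\<forall>n. dist (chain n \<omega>) (chain (Suc n) \<omega>) \<le> (2 * B + 3 * B\<^sup>2) * \<beta>"
        show "0 \<le> S \<beta> \<omega>" by (simp add: S_def sum_nonneg)
        assume S1: "S \<beta> \<omega> < 1"
        have "dist (V t) (x \<beta> \<omega> t) \<le> r / 2" if t: "0 \<le> t" "t \<le> T" for t
        proof -
          have "dist (x \<beta> \<omega> t) (V t) \<le> \<rho> + L * (h + \<beta>) + (2 * K) * h"
          proof (rule dist_le_grid[OF h _ L0 V_lip _ _ t])
            show "dist (x \<beta> \<omega> s) (x \<beta> \<omega> t) \<le> L * (t - s + \<beta>)" if "0 \<le> s" "s \<le> t" for s t
              unfolding x using inc that elim L0 by (intro step_path_modulus) (auto simp: L_def)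
            show "dist (x \<beta> \<omega> (real j * h)) (V (real j * h)) \<le> \<rho>" if "j \<le> nat \<lfloor>T / h\<rfloor>" for j
            proof -
              have "(norm (x \<beta> \<omega> (real j * h) - V (real j * h)))\<^sup>2 \<le> (\<Sum>j\<in>J. (norm (x \<beta> \<omega> (j * h) - V (j * h)))\<^sup>2)"
                using that by (intro member_le_sum) (auto simp: J_def)
              also have "\<dots> \<le> \<rho>\<^sup>2" using S1 \<rho> by (simp add: S_def)
              finally show ?thesis unfolding dist_norm by (rule power2_le_imp_le) (use \<rho> in simp)
            qed
          qed (use K0 in simp)
          moreover have "L * \<beta> \<le> L * h" using elim L0 by (intro mult_left_mono) auto
          ultimately have "dist (x \<beta> \<omega> t) (V t) \<le> r / 2"
            using hr r by (simp add: \<rho>_def distrib_left)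
          then show ?thesis by (simp add: dist_commute)
        qed
        then have "skorokhod_dist (\<lambda>t\<in>{0..}. V t) (x \<beta> \<omega>) \<le> r / 2 + exp (- T)"
          by (intro skorokhod_dist_le T) auto
        then show "skorokhod_dist (\<lambda>t\<in>{0..}. V t) (x \<beta> \<omega>) < r" using T by simp
      qed
      ultimately show ?case by blast
    qed
    with G show "\<exists>S g. (g \<longlongrightarrow> (0::real)) (at_right 0) \<and> (\<forall>\<^sub>F \<beta> in at_right 0. integrable M (S \<beta>) \<and> expectation (S \<beta>) \<le> g \<beta> \<and>
        (AE \<omega> in M. 0 \<le> S \<beta> \<omega> \<and> (S \<beta> \<omega> < 1 \<longrightarrow> skorokhod_dist (\<lambda>t\<in>{0..}. V t) (x \<beta> \<omega>) < r)))"
      by blast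
  qed
  moreover have "x = (\<lambda>\<beta> \<omega>. \<lambda>t\<in>{0..}. oja \<beta> (\<lambda>n. transpose U *v Z n \<omega>) (v0 \<beta> \<omega>) (nat \<lfloor>t / \<beta>\<rfloor>))"
  proof -
    have "oja \<beta> (\<lambda>n. X \<beta> n \<omega>) (X \<beta> 0 \<omega>) n = oja \<beta> (\<lambda>n. transpose U *v Z n \<omega>) (v0 \<beta> \<omega>) n" for \<beta> n \<omega>
      using oja_cong[of n "\<lambda>n. X \<beta> n \<omega>" "\<lambda>n. transpose U *v Z n \<omega>" \<beta> "v0 \<beta> \<omega>"]
      by (simp add: X_def)
    then show ?thesis by (simp add: x_def step_path_def fun_eq_iff)
  qed
  moreover have "oja_ode_solution lam V0 V" unfolding V_def by (rule oja_ode_solution_oja_flow[OF V0])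
  ultimately show ?thesis using oja_ode_solution_unique[OF _ _ V0] by blast
qed

end
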